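(* Let $G$ be a topological group with center $\mathcal{Z}(G)$, $\mu\in\mathcal{P}_{\sigma}(\mathcal{Z}(G))$ a Baire probability measure, and $(V,\rho)$ a uniformly bounded, strongly operator continuous, weakly uniquely $\mu$-stationary Banach $G$-module. Then, for every $n\in\mathbb{N}$, $$Z^{n}(G,\rho)=\overline{B^{n}(G,V_{0})}\oplus Z^{n}(G,V^{\mu}),$$ where $V_{0}:=\overline{\mathrm{im}(\Delta_{\mu})}$. In particular, $\overline{H}_{c}^{n}(G,\rho)\cong\overline{H}_{c}^{n}(G,V^{\mu})$.
   Context: Banach spaces are real or complex; topological groups are not assumed Hausdorff; $\mathbb{N}=\{0,1,2,\dots\}$. The Baire $\sigma$-algebra of a topological space $X$ is the smallest $\sigma$-algebra for which all continuous functions $X\to\mathbb{R}$ are measurable; $\mathcal{P}_\sigma(X)$ is the set of probability measures on it (Baire probability measures). A uniformly bounded Banach $G$-module $(V,\rho)$ is a Banach space $V$ with a group homomorphism $\rho:G\to \mathrm{GL}(V)$, $g\mapsto\rho_g$, into the invertible bounded operators such that $\sup_{g}\Vert\rho_g\Vert<\infty$. It is strongly (resp. weakly) operator continuous if for every $v\in V$ the map $g\mapsto\rho_g(v)$ is continuous for the norm (resp. weak) topology on $V$. For $\mu\in\mathcal{P}_\sigma(G)$, $(V,\rho)$ is $\mu$-integrable if it is weakly operator continuous and for every $v\in V$ there is $\rho_\mu(v)\in V$ with $\phi(\rho_\mu(v))=\int_G\phi(\rho_g(v))\,d\mu(g)$ for all $\phi\in V^*$; then $\rho_\mu\in\mathcal{B}(V)$,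 $\Delta_\mu:=\mathrm{id}_V-\rho_\mu$, and $V^\mu:=\{v\in V\mid\rho_\mu(v)=v\}$. $(V,\rho)$ is weakly uniquely $\mu$-stationary if it is uniformly bounded, $\mu$-integrable, and for every non-zero $\phi\in V^*$ with $\phi\circ\rho_\mu=\phi$ there is $v\in V^\mu$ with $\phi(v)\neq0$. For a measure $\mu$ on the subgroup $\mathcal{Z}(G)\le G$ (subspace topology), these notions refer to $\rho|_{\mathcal{Z}(G)}$. Since $\rho_\mu$ then commutes with $\rho$, $V_0$ (norm closure) and $V^\mu$ are closed $G$-invariant subspaces of $V$. For a uniformly bounded strongly operator continuous Banach $G$-module $(V,\rho)$, $C^n(G,V)$ is the space of continuous functions $G^n\to V$ (norm topology on $V$) with the compact-open topology, and $C^n(G,V)^G$ is the subspace of $f$ with $f(gg_1,\dots,gg_n)=\rho_g(f(g_1,\dots,g_n))$. Define $\partial^n:C^n(G,V)^G\to C^{n+1}(G,V)^G$ by $(\partial^nf)(g_1,\dots,g_{n+1})=\sum_{i=1}^{n+1}(-1)^{i+1}f(g_1,\dots,\widehat{g}_i,\dots,g_{n+1})$. Set $Z^n(G,\rho)=Z^n(G,V):=\ker(\partial^{n+1})\subseteq C^{n+1}(G,V)^G$, $B^n(G,\rho)=B^n(G,V):=\mathrm{im}(\partial^n)\subseteq C^{n+1}(G,V)^G$, and $\overline{H}_c^n(G,\rho)=\overline{H}_c^n(G,V):=Z^n(G,V)/\overline{B^n(G,V)}$ with the quotient topology; closures of coboundary spaces are in the compact-open topology. The symbol $\oplus$ denotes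 a topological direct sum and $\cong$ an isomorphism of topological vector spaces. *)

theory Defs
  imports "HOL-Probability.Probability_Measure" "HOL-Library.Function_Algebras"
begin

section \<open>Banach spaces over the real or complex numbers\<close>

text \<open>
  The scalar fields are exactly the isometric copies of the real and of the complex field.
\<close>

class real_or_complex = real_normed_field + banach + second_countable_topology +
  assumes real_or_complex:
    "\<exists>e :: 'a \<Rightarrow> complex.
       e 1 = 1 \<and> (\<forall>x y. e (x + y) = e x + e y) \<and> (\<forall>x y. e (x * y) = e x * e y) \<and>
       (\<forall>r x. e (r *\<^sub>R x) = r *\<^sub>R e x) \<and> (\<forall>x. norm (e x) = norm x) \<and>
       (range e = \<real> \<or> range e = UNIV)"

instance real :: real_or_complex
proof
  show "\<exists>e :: real \<Rightarrow> complex.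
       e 1 = 1 \<and> (\<forall>x y. e (x + y) = e x + e y) \<and> (\<forall>x y. e (x * y) = e x * e y) \<and>
       (\<forall>r x. e (r *\<^sub>R x) = r *\<^sub>R e x) \<and> (\<forall>x. norm (e x) = norm x) \<and>
       (range e = \<real> \<or> range e = UNIV)"
    by (rule exI[of _ complex_of_real]) (auto simp: Reals_def scaleR_conv_of_real)
qed

instance complex :: real_or_complex
proof
  show "\<exists>e :: complex \<Rightarrow> complex.
       e 1 = 1 \<and> (\<forall>x y. e (x + y) = e x + e y) \<and> (\<forall>x y. e (x * y) = e x * e y) \<and>
       (\<forall>r x. e (r *\<^sub>R x) = r *\<^sub>R e x) \<and> (\<forall>x. norm (e x) = norm x) \<and>
       (range e = \<real> \<or> range e = UNIV)"
    by (rule exI[of _ id]) auto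
qed

text \<open>
  The class \<^class>\<open>banach\<close> supplies the norm and the underlying real structure;
  \<open>smul\<close> is the multiplication by scalars of the ground field.
\<close>

locale banach_space_over = vector_space smul
  for smul :: "'k::real_or_complex \<Rightarrow> 'v::banach \<Rightarrow> 'v" +
  assumes scale_of_real: "smul (of_real r) v = r *\<^sub>R v"
    and norm_scale: "norm (smul c v) = norm c * norm v"

definition dual_space :: "('k::real_or_complex \<Rightarrow> 'v::banach \<Rightarrow> 'v) \<Rightarrow> ('v \<Rightarrow> 'k) set" where
  "dual_space smul = {\<phi>. Vector_Spaces.linear smul (*) \<phi> \<and> bounded_linear \<phi>}"

definition weak_topology :: "('k::real_or_complex \<Rightarrow> 'v::banach \<Rightarrow> 'v) \<Rightarrow> 'v topology" where
  "weak_topology smul = topology_generated_by {\<phi> -` U | \<phi> U. \<phi> \<in> dual_space smul \<and> open U}"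

definition GL :: "('k::real_or_complex \<Rightarrow> 'v::banach \<Rightarrow> 'v) \<Rightarrow> ('v \<Rightarrow> 'v) set" where
  "GL smul = {T. Vector_Spaces.linear smul smul T \<and> bounded_linear T \<and>
                  bij T \<and> bounded_linear (inv T)}"


section \<open>Baire probability measures\<close>

definition baire_sets :: "'a topology \<Rightarrow> 'a set set" where
  "baire_sets X = sigma_sets (topspace X)
     {f -` A \<inter> topspace X | f A. continuous_map X euclideanreal f \<and> A \<in> sets borel}"

definition baire_prob_measures :: "'a topology \<Rightarrow> 'a measure set" where
  "baire_prob_measures X = {M. space M = topspace X \<and> sets M = baire_sets X \<and> prob_space M}"


section \<open>Banach modules\<close>

text \<open>
  Topological groups are types of class \<^class>\<open>topological_group_add\<close>. They are neither assumed
  commutative nor Hausdorff; the group law is merely written additively. The notions below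
  are relative to a subgroup \<open>H\<close> with the subspace topology, so that they apply both to the whole
  group (\<open>H = UNIV\<close>) and to the restriction of a module to the centre.
\<close>

definition group_center :: "'g::group_add set" where
  "group_center = {z. \<forall>g. z + g = g + z}"

definition uniformly_bounded_module ::
  "('k::real_or_complex \<Rightarrow> 'v::banach \<Rightarrow> 'v) \<Rightarrow> 'g::topological_group_add set \<Rightarrow> ('g \<Rightarrow> 'v \<Rightarrow> 'v) \<Rightarrow> bool"
where
  "uniformly_bounded_module smul H \<rho> \<longleftrightarrow>
     (\<forall>g\<in>H. \<rho> g \<in> GL smul) \<and> (\<forall>g\<in>H. \<forall>h\<in>H. \<rho> (g + h) = \<rho> g \<circ> \<rho> h) \<and>
     bdd_above ((\<lambda>g. onorm (\<rho> g)) ` H)"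

definition strongly_operator_continuous ::
  "'g::topological_group_add set \<Rightarrow> ('g \<Rightarrow> 'v::banach \<Rightarrow> 'v) \<Rightarrow> bool" where
  "strongly_operator_continuous H \<rho> \<longleftrightarrow> (\<forall>v. continuous_on H (\<lambda>g. \<rho> g v))"

definition weakly_operator_continuous ::
  "('k::real_or_complex \<Rightarrow> 'v::banach \<Rightarrow> 'v) \<Rightarrow> 'g::topological_group_add set \<Rightarrow> ('g \<Rightarrow> 'v \<Rightarrow> 'v) \<Rightarrow> bool"
where
  "weakly_operator_continuous smul H \<rho> \<longleftrightarrow>
     (\<forall>v. continuous_map (top_of_set H) (weak_topology smul) (\<lambda>g. \<rho> g v))"

definition mu_integrable ::
  "('k::real_or_complex \<Rightarrow> 'v::banach \<Rightarrow> 'v) \<Rightarrow> 'g::topological_group_add set \<Rightarrow> 'g measure \<Rightarrow>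
   ('g \<Rightarrow> 'v \<Rightarrow> 'v) \<Rightarrow> bool"
where
  "mu_integrable smul H \<mu> \<rho> \<longleftrightarrow>
     weakly_operator_continuous smul H \<rho> \<and>
     (\<forall>v. \<exists>w. \<forall>\<phi>\<in>dual_space smul. \<phi> w = (\<integral>g. \<phi> (\<rho> g v) \<partial>\<mu>))"

text \<open>For a \<open>\<mu>\<close>-integrable module the vector below is unique by the Hahn-Banach theorem.\<close>

definition rho_mu ::
  "('k::real_or_complex \<Rightarrow> 'v::banach \<Rightarrow> 'v) \<Rightarrow> 'g::topological_group_add measure \<Rightarrow>
   ('g \<Rightarrow> 'v \<Rightarrow> 'v) \<Rightarrow> 'v \<Rightarrow> 'v"
where
  "rho_mu smul \<mu> \<rho> v = (THE w. \<forall>\<phi>\<in>dual_space smul. \<phi> w = (\<integral>g. \<phi> (\<rho> g v) \<partial>\<mu>))"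

definition Delta_mu ::
  "('k::real_or_complex \<Rightarrow> 'v::banach \<Rightarrow> 'v) \<Rightarrow> 'g::topological_group_add measure \<Rightarrow>
   ('g \<Rightarrow> 'v \<Rightarrow> 'v) \<Rightarrow> 'v \<Rightarrow> 'v"
where
  "Delta_mu smul \<mu> \<rho> v = v - rho_mu smul \<mu> \<rho> v"

definition mu_fixed ::
  "('k::real_or_complex \<Rightarrow> 'v::banach \<Rightarrow> 'v) \<Rightarrow> 'g::topological_group_add measure \<Rightarrow>
   ('g \<Rightarrow> 'v \<Rightarrow> 'v) \<Rightarrow> 'v set"
where
  "mu_fixed smul \<mu> \<rho> = {v. rho_mu smul \<mu> \<rho> v = v}"

definition weakly_uniquely_stationary ::
  "('k::real_or_complex \<Rightarrow> 'v::banach \<Rightarrow> 'v) \<Rightarrow> 'g::topological_group_add set \<Rightarrow> 'g measure \<Rightarrow>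
   ('g \<Rightarrow> 'v \<Rightarrow> 'v) \<Rightarrow> bool"
where
  "weakly_uniquely_stationary smul H \<mu> \<rho> \<longleftrightarrow>
     uniformly_bounded_module smul H \<rho> \<and> mu_integrable smul H \<mu> \<rho> \<and>
     (\<forall>\<phi>\<in>dual_space smul.
        \<phi> \<noteq> (\<lambda>_. 0) \<and> \<phi> \<circ> rho_mu smul \<mu> \<rho> = \<phi> \<longrightarrow> (\<exists>v\<in>mu_fixed smul \<mu> \<rho>. \<phi> v \<noteq> 0))"


section \<open>Direct sums, quotients and isomorphisms of topological vector spaces\<close>

definition topological_direct_sum ::
  "('k::field \<Rightarrow> 'a::ab_group_add \<Rightarrow> 'a) \<Rightarrow> 'a topology \<Rightarrow> 'a set \<Rightarrow> 'a set \<Rightarrow> bool"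
where
  "topological_direct_sum s X A B \<longleftrightarrow>
     module.subspace s A \<and> module.subspace s B \<and> A \<subseteq> topspace X \<and> B \<subseteq> topspace X \<and>
     homeomorphic_map (prod_topology (subtopology X A) (subtopology X B)) X (\<lambda>(a, b). a + b)"

text \<open>The finest topology on the image of \<open>q\<close> for which \<open>q\<close> is continuous on \<open>X\<close>.\<close>

definition quotient_topology :: "'a topology \<Rightarrow> ('a \<Rightarrow> 'b) \<Rightarrow> 'b topology" where
  "quotient_topology X q =
     topology (\<lambda>U. U \<subseteq> q ` topspace X \<and> openin X {x \<in> topspace X. q x \<in> U})"

lemma openin_quotient_topology:
  "openin (quotient_topology X q) U \<longleftrightarrow>
     U \<subseteq> q ` topspace X \<and> openin X {x \<in> topspace X. q x \<in> U}"
proof -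
  have "istopology (\<lambda>U. U \<subseteq> q ` topspace X \<and> openin X {x \<in> topspace X. q x \<in> U})"
    unfolding istopology_def
  proof (intro conjI allI impI)
    fix S T
    assume "S \<subseteq> q ` topspace X \<and> openin X {x \<in> topspace X. q x \<in> S}"
      and "T \<subseteq> q ` topspace X \<and> openin X {x \<in> topspace X. q x \<in> T}"
    then show "S \<inter> T \<subseteq> q ` topspace X" "openin X {x \<in> topspace X. q x \<in> S \<inter> T}"
      using openin_Int[of X "{x \<in> topspace X. q x \<in> S}" "{x \<in> topspace X. q x \<in> T}"]
      by (auto simp: Int_def conj_commute conj_left_commute)
  next
    fix K
    assume K: "\<forall>S\<in>K. S \<subseteq> q ` topspace X \<and> openin X {x \<in> topspace X. q x \<in> S}"
    then show "\<Union>K \<subseteq> q ` topspace X" by blast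
    have "openin X (\<Union>S\<in>K. {x \<in> topspace X. q x \<in> S})"
      using K by blast
    moreover have "(\<Union>S\<in>K. {x \<in> topspace X. q x \<in> S}) = {x \<in> topspace X. q x \<in> \<Union>K}"
      by blast
    ultimately show "openin X {x \<in> topspace X. q x \<in> \<Union>K}" by simp
  qed
  then show ?thesis
    unfolding quotient_topology_def by simp
qed

lemma topspace_quotient_topology: "topspace (quotient_topology X q) = q ` topspace X"
proof -
  have "{x \<in> topspace X. q x \<in> q ` topspace X} = topspace X"
    by auto
  then have "openin (quotient_topology X q) (q ` topspace X)"
    by (simp add: openin_quotient_topology)
  then show ?thesis
    by (meson openin_quotient_topology openin_subset openin_topspace subset_antisym)
qed

lemma quotient_map_quotient_topology: "quotient_map X (quotient_topology X q) q"
  by (auto simp: quotient_map_def topspace_quotient_topology openin_quotient_topology)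

record ('k, 'a) tvs =
  tvs_topology :: "'a topology"
  tvs_add :: "'a \<Rightarrow> 'a \<Rightarrow> 'a"
  tvs_scale :: "'k \<Rightarrow> 'a \<Rightarrow> 'a"

text \<open>
  The quotient of the space with topology \<open>X\<close> by its subspace \<open>N\<close>. Points are the cosets
  \<open>f +o N\<close> and \<open>A + B\<close> is the sum of sets. In the scalar multiple, adding \<open>N\<close> matters
  only for the scalar \<open>0\<close>.
\<close>

definition tvs_quotient ::
  "('k \<Rightarrow> 'a::ab_group_add \<Rightarrow> 'a) \<Rightarrow> 'a topology \<Rightarrow> 'a set \<Rightarrow> ('k, 'a set) tvs"
where
  "tvs_quotient s X N =
     \<lparr> tvs_topology = quotient_topology X (\<lambda>f. f +o N),
       tvs_add = (\<lambda>A B. A + B),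
       tvs_scale = (\<lambda>c A. s c ` A + N) \<rparr>"

definition tvs_isomorphic :: "('k, 'a) tvs \<Rightarrow> ('k, 'b) tvs \<Rightarrow> bool" where
  "tvs_isomorphic E F \<longleftrightarrow>
     (\<exists>h. homeomorphic_map (tvs_topology E) (tvs_topology F) h \<and>
          (\<forall>x\<in>topspace (tvs_topology E). \<forall>y\<in>topspace (tvs_topology E).
             h (tvs_add E x y) = tvs_add F (h x) (h y)) \<and>
          (\<forall>c. \<forall>x\<in>topspace (tvs_topology E). h (tvs_scale E c x) = tvs_scale F c (h x)))"


section \<open>Continuous cohomology\<close>

text \<open>
  A point of \<open>G\<^sup>n\<close> is a function on the naturals that is \<open>undefined\<close> outside \<open>{..<n}\<close>.
  A function on \<open>G\<^sup>n\<close> is represented by its extension by \<open>0\<close> to all functions on the naturals,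
  so that the pointwise operations are those of the function type. Coordinates are numbered from
  \<open>0\<close>. The set \<open>W\<close> is the closed invariant subspace in which cochains take their values,
  e.g. \<open>W = UNIV\<close> for the whole module.
\<close>

definition group_power :: "nat \<Rightarrow> (nat \<Rightarrow> 'g::topological_space) topology" where
  "group_power n = product_topology (\<lambda>_. euclidean) {..<n}"

definition cochains ::
  "nat \<Rightarrow> 'v::real_normed_vector set \<Rightarrow> ((nat \<Rightarrow> 'g::topological_space) \<Rightarrow> 'v) set" where
  "cochains n W = {f. continuous_map (group_power n) (top_of_set W) f \<and>
                      (\<forall>x. x \<notin> topspace (group_power n) \<longrightarrow> f x = 0)}"

definition compact_open_topology ::
  "nat \<Rightarrow> 'v::real_normed_vector set \<Rightarrow> ((nat \<Rightarrow> 'g::topological_space) \<Rightarrow> 'v) topology" where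
  "compact_open_topology n W = topology_generated_by
     {{f \<in> cochains n W. f ` K \<subseteq> U} | K U. compactin (group_power n) K \<and> openin (top_of_set W) U}"

definition invariant_cochains ::
  "('g::topological_group_add \<Rightarrow> 'v::banach \<Rightarrow> 'v) \<Rightarrow> nat \<Rightarrow> 'v set \<Rightarrow> ((nat \<Rightarrow> 'g) \<Rightarrow> 'v) set"
where
  "invariant_cochains \<rho> n W = {f \<in> cochains n W.
     \<forall>g. \<forall>x\<in>topspace (group_power n). f (\<lambda>j\<in>{..<n}. g + x j) = \<rho> g (f x)}"

definition invariant_cochain_topology ::
  "('g::topological_group_add \<Rightarrow> 'v::banach \<Rightarrow> 'v) \<Rightarrow> nat \<Rightarrow> 'v set \<Rightarrow> ((nat \<Rightarrow> 'g) \<Rightarrow> 'v) topology"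
where
  "invariant_cochain_topology \<rho> n W =
     subtopology (compact_open_topology n W) (invariant_cochains \<rho> n W)"

text \<open>Omitting the coordinate \<open>i\<close> of a point of \<open>G\<^bsup>n+1\<^esup>\<close> gives a point of \<open>G\<^sup>n\<close>.\<close>

definition omit :: "nat \<Rightarrow> nat \<Rightarrow> (nat \<Rightarrow> 'g) \<Rightarrow> (nat \<Rightarrow> 'g)" where
  "omit n i x = (\<lambda>j\<in>{..<n}. x (if j < i then j else Suc j))"

definition coboundary_map ::
  "nat \<Rightarrow> ((nat \<Rightarrow> 'g::topological_space) \<Rightarrow> 'v::real_normed_vector) \<Rightarrow> ((nat \<Rightarrow> 'g) \<Rightarrow> 'v)" where
  "coboundary_map n f = (\<lambda>x. if x \<in> topspace (group_power (Suc n))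
      then \<Sum>i\<le>n. (- 1) ^ i *\<^sub>R f (omit n i x) else 0)"

definition cocycles ::
  "('g::topological_group_add \<Rightarrow> 'v::banach \<Rightarrow> 'v) \<Rightarrow> nat \<Rightarrow> 'v set \<Rightarrow> ((nat \<Rightarrow> 'g) \<Rightarrow> 'v) set"
where
  "cocycles \<rho> n W = {f \<in> invariant_cochains \<rho> (Suc n) W. coboundary_map (Suc n) f = 0}"

definition coboundaries ::
  "('g::topological_group_add \<Rightarrow> 'v::banach \<Rightarrow> 'v) \<Rightarrow> nat \<Rightarrow> 'v set \<Rightarrow> ((nat \<Rightarrow> 'g) \<Rightarrow> 'v) set"
where
  "coboundaries \<rho> n W = coboundary_map n ` invariant_cochains \<rho> n W"

definition closed_coboundaries ::
  "('g::topological_group_add \<Rightarrow> 'v::banach \<Rightarrow> 'v) \<Rightarrow> nat \<Rightarrow> 'v set \<Rightarrow> ((nat \<Rightarrow> 'g) \<Rightarrow> 'v) set"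
where
  "closed_coboundaries \<rho> n W =
     invariant_cochain_topology \<rho> (Suc n) W closure_of coboundaries \<rho> n W"

definition cocycle_topology ::
  "('g::topological_group_add \<Rightarrow> 'v::banach \<Rightarrow> 'v) \<Rightarrow> nat \<Rightarrow> 'v set \<Rightarrow> ((nat \<Rightarrow> 'g) \<Rightarrow> 'v) topology"
where
  "cocycle_topology \<rho> n W =
     subtopology (invariant_cochain_topology \<rho> (Suc n) W) (cocycles \<rho> n W)"

definition pointwise_scale :: "('k \<Rightarrow> 'v \<Rightarrow> 'v) \<Rightarrow> 'k \<Rightarrow> ('a \<Rightarrow> 'v) \<Rightarrow> ('a \<Rightarrow> 'v)" where
  "pointwise_scale smul c f = (\<lambda>x. smul c (f x))"

definition reduced_cohomology ::
  "('k::real_or_complex \<Rightarrow> 'v::banach \<Rightarrow> 'v) \<Rightarrow> ('g::topological_group_add \<Rightarrow> 'v \<Rightarrow> 'v) \<Rightarrow>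
   nat \<Rightarrow> 'v set \<Rightarrow> ('k, ((nat \<Rightarrow> 'g) \<Rightarrow> 'v) set) tvs"
where
  "reduced_cohomology smul \<rho> n W =
     tvs_quotient (pointwise_scale smul) (cocycle_topology \<rho> n W) (closed_coboundaries \<rho> n W)"

end

theory Submission
  imports Defs
begin

text \<open>
  With respect to the invariant norm \<open>sup\<^sub>g \<parallel>\<rho>\<^sub>g v\<parallel>\<close> the operator \<open>\<rho>\<^sub>\<mu>\<close> is a contraction, so its Cesaro
  means converge to \<open>0\<close> on \<open>V\<^sub>0\<close> and fix \<open>V\<^sup>\<mu>\<close>; weak unique stationarity and the Hahn-Banach theorem make
  them converge everywhere, to a projection \<open>P\<close> onto \<open>V\<^sup>\<mu>\<close> along \<open>V\<^sub>0\<close> that commutes with \<open>\<rho>\<close>.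
  Composing with \<open>P\<close> splits the cocycles. It remains to see that every \<open>V\<^sub>0\<close>-valued cocycle \<open>f\<close> is a
  limit of coboundaries. For central \<open>z\<close> the prism homotopy shows that \<open>f - \<rho>\<^sub>z f\<close> is a coboundary; hence so
  is \<open>f - T f\<close> for every \<open>T\<close> in the convex semigroup generated by the \<open>\<rho>\<^sub>z\<close>, and a second application of
  the Hahn-Banach theorem yields such \<open>T\<close> that are uniformly small on a given compact subset of \<open>V\<^sub>0\<close>.
  The operator \<open>\<rho>\<^sub>\<mu>\<close> itself cannot be used for \<open>T\<close>, since integrating the homotopy over \<open>z\<close> need not make
  sense.
\<close>

section \<open>The Hahn-Banach theorem\<close>

text \<open>Weak unique stationarity speaks about functionals only. To turn it into convergence for
  every vector, the vectors with convergent Cesaro means must form a closed subspace, so that a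
  functional can annihilate it. Closedness needs a bound on the means that is independent of their
  length; iterating an estimate of \<open>rho_mu\<close> in the given norm would produce powers of
  the module bound, which is why the invariant norm is used.

  On the side of cocycles it is not enough to shrink vectors one by one, because a neighbourhood in
  the compact-open topology tests a whole compact set of values. The Cesaro means of a single
  \<open>\<rho>\<^sub>z\<close> are only known to shrink the vectors v -
  \<open>\<rho>\<^sub>z\<close> v, so means of different central elements are combined by
  composition. Since all of them are contractions for the invariant norm, a later factor does not
  undo what an earlier one achieved, and a finite net of the compact set suffices. That the averages
  commute makes the infimum over them a seminorm, to which the Hahn-Banach theorem applies. The
  operator obtained depends on the compact set and on the tolerance, so the argument yields limits
  of coboundaries and hence a statement on reduced cohomology.\<close>

definition sublinear :: "('v::real_vector \<Rightarrow> real) \<Rightarrow> bool" where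
  "sublinear q \<longleftrightarrow> (\<forall>x y. q (x + y) \<le> q x + q y) \<and> (\<forall>r x. 0 < r \<longrightarrow> q (r *\<^sub>R x) = r * q x)"

lemma sublinearD:
  assumes "sublinear q"
  shows "q (x + y) \<le> q x + q y" and "0 < r \<Longrightarrow> q (r *\<^sub>R x) = r * q x"
  using assms unfolding sublinear_def by auto

lemma sublinear_0: "sublinear q \<Longrightarrow> q 0 = 0"
  using sublinearD(2)[of q 2 0] by simp

lemma sublinear_scaleR: "sublinear q \<Longrightarrow> 0 \<le> r \<Longrightarrow> q (r *\<^sub>R x) = r * q x"
  by (cases "r = 0") (auto simp: sublinear_0 sublinearD(2))

lemma sublinear_minus_ge: "sublinear q \<Longrightarrow> - q (- x) \<le> q x"
  using sublinearD(1)[of q x "- x"] by (simp add: sublinear_0)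

text \<open>\<open>q'\<close> x is the infimum over t \<ge> 0 of q (x + t y) - t q y, which is
  finite because t q y \<le> q (x + t y) + q (- x). The parameter t = 0 gives \<open>q'\<close>
  \<le> q, and t = 1 gives the bound at - y. A functional that cannot be lowered in this way for any
  y is odd.\<close>

lemma sublinear_shrink:
  fixes q :: "'v::real_vector \<Rightarrow> real"
  assumes q: "sublinear q"
  obtains q' where "sublinear q'" "\<And>x. q' x \<le> q x" "q' (- y) \<le> - q y"
proof
  define s where "s x t = q (x + t *\<^sub>R y) - t * q y" for x t
  define q' where "q' x = (INF t\<in>{0..}. s x t)" for x
  have lower: "- q (- x) \<le> s x t" if "0 \<le> t" for x t
    using sublinearD(1)[OF q, of "x + t *\<^sub>R y" "- x"] sublinear_scaleR[OF q that]
    by (simp add: s_def)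
  have bdd: "bdd_below (s x ` {0..})" for x
    by (rule bdd_belowI2[of _ "- q (- x)"]) (use lower in auto)
  have le: "q' x \<le> s x t" if "0 \<le> t" for x t
    unfolding q'_def by (rule cINF_lower[OF bdd]) (use that in auto)
  have ge: "c \<le> q' x" if "\<And>t. 0 \<le> t \<Longrightarrow> c \<le> s x t" for c x
    unfolding q'_def by (rule cINF_greatest) (use that in auto)
  show "q' x \<le> q x" for x
    using le[of 0 x] by (simp add: s_def)
  show "q' (- y) \<le> - q y"
    using le[of 1 "- y"] by (simp add: s_def sublinear_0[OF q])
  show "sublinear q'"
    unfolding sublinear_def
  proof (intro conjI allI impI)
    fix x z
    \<comment> \<open>The two infima are taken one after the other; t + u is the parameter used for
      the sum.\<close>
    have "q' (x + z) - s z u \<le> s x t" if "0 \<le> t" "0 \<le> u" for t u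
    proof -
      have "s (x + z) (t + u) \<le> s x t + s z u"
        using sublinearD(1)[OF q, of "x + t *\<^sub>R y" "z + u *\<^sub>R y"]
        by (simp add: s_def algebra_simps)
      with le[of "t + u" "x + z"] that show ?thesis by simp
    qed
    then have "q' (x + z) - s z u \<le> q' x" if "0 \<le> u" for u
      by (intro ge) (use that in auto)
    then have "q' (x + z) - q' x \<le> s z u" if "0 \<le> u" for u
      using that by (simp add: algebra_simps)
    then have "q' (x + z) - q' x \<le> q' z"
      by (rule ge)
    then show "q' (x + z) \<le> q' x + q' z" by simp
  next
    fix r :: real and x assume r: "0 < r"
    \<comment> \<open>Only one inequality is proved; the reverse one is its instance for the factor
      1 / r at the vector r x.\<close>
    have le': "q' (c *\<^sub>R z) \<le> c * q' z" if c: "0 < c" for c :: real and z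
    proof -
      have "q' (c *\<^sub>R z) / c \<le> s z t" if "0 \<le> t" for t
      proof -
        have "s (c *\<^sub>R z) (c * t) = c * s z t"
          using sublinearD(2)[OF q c, of "z + t *\<^sub>R y"] by (simp add: s_def algebra_simps)
        then show ?thesis
          using le[of "c * t" "c *\<^sub>R z"] that c by (simp add: field_simps)
      qed
      then have "q' (c *\<^sub>R z) / c \<le> q' z"
        by (rule ge)
      with c show ?thesis by (simp add: field_simps)
    qed
    show "q' (r *\<^sub>R x) = r * q' x"
      using le'[OF r, of x] le'[of "1 / r" "r *\<^sub>R x"] r by (simp add: field_simps)
  qed
qed

text \<open>The pointwise infimum works. It is finite by comparison with a fixed member of the
  chain, and it is subadditive because the smaller one, s, of two members q and r satisfies s (x +
  y) \<le> q x + r y.\<close>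

lemma sublinear_chain_lower_bound:
  assumes "C \<noteq> {}" and C: "\<And>q. q \<in> C \<Longrightarrow> sublinear q"
    and chain: "\<And>q r. q \<in> C \<Longrightarrow> r \<in> C \<Longrightarrow> q \<le> r \<or> r \<le> q"
  shows "\<exists>u. sublinear u \<and> (\<forall>q\<in>C. u \<le> q)"
proof -
  obtain q0 where q0: "q0 \<in> C" using assms(1) by blast
  define u where "u x = (INF q\<in>C. q x)" for x
  have bdd: "bdd_below ((\<lambda>q. q x) ` C)" for x
  proof (rule bdd_belowI2)
    fix q assume q: "q \<in> C"
    \<comment> \<open>A member above \<open>q0\<close> is bounded below by \<open>q0\<close> x; for
      a member below \<open>q0\<close> the bound comes from its value at - x.\<close>
    from chain[OF q q0] show "min (q0 x) (- q0 (- x)) \<le> q x"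
    proof
      assume "q \<le> q0"
      then have "- q0 (- x) \<le> - q (- x)" by (simp add: le_fun_def)
      also have "\<dots> \<le> q x" by (rule sublinear_minus_ge[OF C[OF q]])
      finally show ?thesis by simp
    qed (auto simp: le_fun_def min.coboundedI1)
  qed
  have le: "u x \<le> q x" if "q \<in> C" for x q
    unfolding u_def by (rule cINF_lower[OF bdd that])
  have ge: "c \<le> u x" if "\<And>q. q \<in> C \<Longrightarrow> c \<le> q x" for c x
    unfolding u_def by (rule cINF_greatest[OF assms(1) that])
  have "sublinear u"
    unfolding sublinear_def
  proof (intro conjI allI impI)
    fix x y
    have *: "u (x + y) \<le> q x + r y" if "q \<in> C" "r \<in> C" for q r
      using chain[OF that]
    proof
      assume "q \<le> r"
      then have "q (x + y) \<le> q x + r y"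
        using sublinearD(1)[OF C[OF that(1)], of x y] by (auto simp: le_fun_def intro: order_trans)
      then show ?thesis using le[OF that(1), of "x + y"] by simp
    next
      assume "r \<le> q"
      then have "r (x + y) \<le> q x + r y"
        using sublinearD(1)[OF C[OF that(2)], of x y]
        by (smt (verit) le_fun_def)
      then show ?thesis using le[OF that(2), of "x + y"] by simp
    qed
    have "u (x + y) - r y \<le> u x" if "r \<in> C" for r
      by (rule ge) (use *[OF _ that] in \<open>simp add: algebra_simps\<close>)
    then have "u (x + y) - u x \<le> u y"
      by (intro ge) (simp add: algebra_simps)
    then show "u (x + y) \<le> u x + u y" by simp
  next
    fix r :: real and x assume r: "0 < r"
    show "u (r *\<^sub>R x) = r * u x"
    proof (rule antisym)
      have "u (r *\<^sub>R x) / r \<le> u x"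
      proof (rule ge)
        fix q assume "q \<in> C"
        then show "u (r *\<^sub>R x) / r \<le> q x"
          using le[of q "r *\<^sub>R x"] sublinearD(2)[OF C r, of q x] r by (simp add: field_simps)
      qed
      then show "u (r *\<^sub>R x) \<le> r * u x" using r by (simp add: field_simps)
      show "r * u x \<le> u (r *\<^sub>R x)"
      proof (rule ge)
        fix q assume "q \<in> C"
        then show "r * u x \<le> q (r *\<^sub>R x)"
          using le[of q x] sublinearD(2)[OF C r, of q x] r by simp
      qed
    qed
  qed
  with le show ?thesis by (intro exI[of _ u]) (auto simp: le_fun_def)
qed

text \<open>Oddness turns subadditivity at - x and - y into superadditivity at x and y.\<close>

lemma sublinear_odd_imp_linear:
  fixes q :: "'v::real_vector \<Rightarrow> real"
  assumes q: "sublinear q" and odd: "\<And>y. q (- y) = - q y"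
  shows "linear q"
proof (rule linearI)
  fix x y
  show "q (x + y) = q x + q y"
    using sublinearD(1)[OF q, of x y] sublinearD(1)[OF q, of "- x" "- y"] odd[of "x + y"] odd[of x] odd[of y]
    by simp
next
  fix r x
  show "q (r *\<^sub>R x) = r *\<^sub>R q x"
    using sublinear_scaleR[OF q, of r x] sublinear_scaleR[OF q, of "- r" x] odd[of "r *\<^sub>R x"]
    by (cases "0 \<le> r") auto
qed

text \<open>A minimal sublinear functional below \<open>p\<close> is linear, because \<open>sublinear_shrink\<close>
  cannot decrease it.\<close>

lemma Hahn_Banach_sublinear:
  fixes p :: "'v::real_vector \<Rightarrow> real"
  assumes p: "sublinear p"
  obtains f where "linear f" "\<And>x. f x \<le> p x" "f x0 = p x0"
proof -
  \<comment> \<open>Shrinking once at \<open>x0\<close> before Zorn's lemma is applied forces every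
    functional below \<open>p'\<close> to be at most - p x0 at - x0, so a linear one attains p at
    \<open>x0\<close>.\<close>
  obtain p' where p': "sublinear p'" "\<And>x. p' x \<le> p x" "p' (- x0) \<le> - p x0"
    using sublinear_shrink[OF p, of x0] by blast
  define A where "A = {q. sublinear q \<and> q \<le> p'}"
  \<comment> \<open>The order is reversed, so that the maximal element supplied by Zorn's lemma is a
    minimal functional.\<close>
  have "\<exists>m\<in>A. \<forall>a\<in>A. a \<le> m \<longrightarrow> a = m"
  proof (rule predicate_Zorn)
    show "partial_order_on A (relation_of (\<lambda>x y. y \<le> x) A)"
      by (rule partial_order_on_relation_ofI) auto
    fix C assume C: "C \<in> Chains (relation_of (\<lambda>x y. y \<le> x) A)"
    then have CA: "C \<subseteq> A" by (rule Chains_relation_of)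
    show "\<exists>u\<in>A. \<forall>a\<in>C. u \<le> a"
    proof (cases "C = {}")
      case True
      then show ?thesis using p'(1) by (auto simp: A_def)
    next
      case False
      have "\<exists>u. sublinear u \<and> (\<forall>q\<in>C. u \<le> q)"
      proof (rule sublinear_chain_lower_bound[OF False])
        show "sublinear q" if "q \<in> C" for q using CA that by (auto simp: A_def)
        show "q \<le> r \<or> r \<le> q" if "q \<in> C" "r \<in> C" for q r
          using C that by (auto simp: Chains_def relation_of_def)
      qed
      then obtain u where u: "sublinear u" "\<And>q. q \<in> C \<Longrightarrow> u \<le> q" by blast
      moreover have "u \<in> A"
        using False u CA by (auto simp: A_def intro: order_trans)
      ultimately show ?thesis by blast
    qed
  qed
  then obtain m where m: "sublinear m" "m \<le> p'" and min: "\<And>a. sublinear a \<Longrightarrow> a \<le> m \<Longrightarrow> a = m"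
    by (auto simp: A_def intro: order_trans)
  have "m (- y) = - m y" for y
  proof (rule antisym)
    obtain m' where m': "sublinear m'" "\<And>x. m' x \<le> m x" "m' (- y) \<le> - m y"
      using sublinear_shrink[OF m(1), of y] by blast
    with min[of m'] show "m (- y) \<le> - m y" by (simp add: le_fun_def)
    show "- m y \<le> m (- y)" using sublinear_minus_ge[OF m(1), of "- y"] by simp
  qed
  note odd = this
  show thesis
  proof
    show "linear m" by (rule sublinear_odd_imp_linear[OF m(1) odd])
    show le: "m x \<le> p x" for x using m(2) p'(2)[of x] by (auto simp: le_fun_def intro: order_trans)
    have "m (- x0) \<le> - p x0" using m(2) p'(3) by (auto simp: le_fun_def intro: order_trans)
    with le[of x0] odd[of x0] show "m x0 = p x0" by simp
  qed
qed

section \<open>The Hahn-Banach theorem for scalar-linear functionals\<close>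

context banach_space_over
begin

definition seminorm :: "('v \<Rightarrow> real) \<Rightarrow> bool" where
  "seminorm p \<longleftrightarrow> (\<forall>x y. p (x + y) \<le> p x + p y) \<and> (\<forall>c x. p (smul c x) = norm c * p x)"

text \<open>One inequality is enough, since its instance for the inverse scalar is the reverse
  inequality.\<close>

lemma seminormI:
  assumes add: "\<And>x y. p (x + y) \<le> p x + p y" and "p 0 = 0"
    and le: "\<And>c x. c \<noteq> 0 \<Longrightarrow> p (smul c x) \<le> norm c * p x"
  shows "seminorm p"
proof -
  have "p (smul c x) = norm c * p x" for c :: 'k and x
  proof (cases "c = 0")
    case False
    then show ?thesis
      using le[of c x] le[of "inverse c" "smul c x"] by (simp add: norm_divide field_simps)
  qed (simp add: assms(2))
  with add show ?thesis by (simp add: seminorm_def)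
qed

lemma seminorm_norm: "seminorm norm"
  by (simp add: seminorm_def norm_triangle_ineq norm_scale)

lemma scale_scaleR: "smul (of_real r * c) v = r *\<^sub>R smul c v"
  by (metis scale_of_real scale_scale)

lemma bounded_linear_dual_space:
  "\<phi> \<in> dual_space smul \<Longrightarrow> bounded_linear \<phi>"
  by (simp add: dual_space_def)

text \<open>Over the complex field, a real functional \<open>f\<close> is complexified to
  \<open>x \<mapsto> f x - i f (i x)\<close>; multiplying by a phase reduces its norm bound to the bound on \<open>f\<close>.\<close>

lemma Hahn_Banach_seminorm:
  assumes p: "seminorm p"
  obtains \<phi> where "Vector_Spaces.linear smul (*) \<phi>" "\<And>x. norm (\<phi> x) \<le> p x" "norm (\<phi> x0) = p x0"
proof -
  have p_add: "p (x + y) \<le> p x + p y" and p_scale: "p (smul c x) = norm c * p x" for x y c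
    using p by (auto simp: seminorm_def)
  have "p (r *\<^sub>R x) = \<bar>r\<bar> * p x" for r x
    by (metis scale_of_real p_scale norm_of_real)
  then have "sublinear p"
    by (simp add: sublinear_def p_add)
  then obtain f where f: "linear f" "\<And>x. f x \<le> p x" "f x0 = p x0"
    using Hahn_Banach_sublinear[of p x0] by blast
  have f_minus: "f (- x) = - f x" and f_scaleR: "f (r *\<^sub>R x) = r * f x"
    and f_add: "f (x + y) = f x + f y" for x y r
    using f(1) by (auto simp: linear_neg linear_cmul linear_add)
  obtain e :: "'k \<Rightarrow> complex" where e1: "e 1 = 1" and e_add: "\<And>x y. e (x + y) = e x + e y"
    and e_mult: "\<And>x y. e (x * y) = e x * e y" and e_scale: "\<And>r x. e (r *\<^sub>R x) = r *\<^sub>R e x"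
    and e_norm: "\<And>x. norm (e x) = norm x" and e_range: "range e = \<real> \<or> range e = UNIV"
    using real_or_complex[where 'a='k] by blast
  have e_diff: "e (x - y) = e x - e y" for x y
    by (metis add_diff_cancel_right' diff_add_cancel e_add)
  have e_inj: "x = y" if "e x = e y" for x y
    using e_norm[of "x - y"] e_diff[of x y] that by simp
  have e_of_real: "e (of_real r) = of_real r" for r
    using e_scale[of r 1] by (simp add: e1 of_real_def)
  have vs: "vector_space ((*) :: 'k \<Rightarrow> 'k \<Rightarrow> 'k)"
    by unfold_locales (auto simp: algebra_simps)
  have linearI': "Vector_Spaces.linear smul (*) \<phi>"
    if "\<And>x y. \<phi> (x + y) = \<phi> x + \<phi> y" "\<And>c x. \<phi> (smul c x) = c * \<phi> x" for \<phi> :: "'v \<Rightarrow> 'k"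
    unfolding Vector_Spaces.linear_iff
    using that vector_space_axioms vs by auto
  from e_range show thesis
  proof
    assume real: "range e = \<real>"
    have k_real: "\<exists>r. c = (of_real r :: 'k)" for c
    proof -
      have "e c \<in> \<real>" using real by auto
      then obtain r where "e c = of_real r" by (auto elim: Reals_cases)
      then show ?thesis using e_inj[of c "of_real r"] e_of_real by auto
    qed
    show thesis
    proof (rule that[of "\<lambda>x. of_real (f x)"])
      show "Vector_Spaces.linear smul (*) (\<lambda>x. of_real (f x) :: 'k)"
      proof (rule linearI')
        fix c :: 'k and x
        obtain r where "c = of_real r" using k_real[of c] by blast
        then show "(of_real (f (smul c x)) :: 'k) = c * of_real (f x)"
          by (simp add: scale_of_real f_scaleR)
      qed (simp add: f_add)
      show "norm (of_real (f x) :: 'k) \<le> p x" for x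
        using f(2)[of x] f(2)[of "- x"] \<open>\<And>r x. p (r *\<^sub>R x) = \<bar>r\<bar> * p x\<close>[of "-1" x]
        by (simp add: f_minus)
      have "0 \<le> p x0"
        using f(2)[of x0] f(2)[of "- x0"] \<open>\<And>r x. p (r *\<^sub>R x) = \<bar>r\<bar> * p x\<close>[of "-1" x0]
        by (simp add: f_minus)
      then show "norm (of_real (f x0) :: 'k) = p x0"
        by (simp add: f(3))
    qed
  next
    assume "range e = UNIV"
    then have "\<exists>c. e c = z" for z by (metis surjD)
    then obtain i where i: "e i = \<i>" by blast
    have ii: "i * i = - 1"
      by (rule e_inj) (simp add: e_mult i, metis e_of_real of_real_1 of_real_minus)
    define \<phi> :: "'v \<Rightarrow> 'k" where "\<phi> x = of_real (f x) - i * of_real (f (smul i x))" for x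
    have e\<phi>: "e (\<phi> x) = Complex (f x) (- f (smul i x))" for x
      by (simp add: \<phi>_def e_diff e_mult e_of_real i complex_eq_iff)
    have dec: "\<exists>a b. c = of_real a + of_real b * i" for c :: 'k
    proof (intro exI)
      show "c = of_real (Re (e c)) + of_real (Im (e c)) * i"
        by (rule e_inj) (simp add: e_add e_mult e_of_real i complex_eq_iff)
    qed
    have \<phi>_scale: "\<phi> (smul c x) = c * \<phi> x" for c x
    proof -
      obtain a b where c: "c = of_real a + of_real b * i" using dec by blast
      have 1: "smul c x = a *\<^sub>R x + b *\<^sub>R smul i x"
        by (simp add: c scale_left_distrib scale_of_real scale_scaleR)
      have "i * c = of_real a * i + of_real b * (i * i)"
        by (simp add: c algebra_simps)
      then have "i * c = of_real a * i + of_real (- b) * 1"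
        by (simp add: ii)
      then have 2: "smul i (smul c x) = a *\<^sub>R smul i x - b *\<^sub>R x"
        by (simp only: scale_scale scale_left_distrib scale_scaleR scale_one) simp
      have 3: "f (smul c x) = a * f x + b * f (smul i x)"
        by (simp only: 1 f_add f_scaleR)
      have 4: "f (smul i (smul c x)) = a * f (smul i x) - b * f x"
        by (simp only: 2 linear_diff[OF f(1)] f_scaleR)
      have "e c = Complex a b"
        by (simp add: c e_add e_mult e_of_real i complex_eq_iff)
      then show ?thesis
        by (intro e_inj) (simp only: e\<phi> e_mult 3 4, simp add: complex_eq_iff algebra_simps)
    qed
    have bound: "norm (\<phi> x) \<le> p x" for x
    proof -
      obtain c where c: "norm c = 1" "c * \<phi> x = of_real (norm (\<phi> x))"
      proof (cases "\<phi> x = 0")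
        case False
        then show thesis
          by (intro that[of "of_real (norm (\<phi> x)) / \<phi> x"]) (auto simp: norm_divide)
      qed (auto intro: that[of 1])
      have "e (\<phi> (smul c x)) = of_real (norm (\<phi> x))"
        using c(2) by (simp add: \<phi>_scale e_of_real)
      then have "norm (\<phi> x) = f (smul c x)"
        by (simp add: e\<phi> complex_eq_iff)
      also have "\<dots> \<le> p x" using f(2)[of "smul c x"] c(1) by (simp add: p_scale)
      finally show ?thesis .
    qed
    show thesis
    proof (rule that[of \<phi>])
      show "Vector_Spaces.linear smul (*) \<phi>"
        by (rule linearI') (simp_all add: \<phi>_scale, simp add: \<phi>_def f_add scale_right_distrib algebra_simps)
      show "norm (\<phi> x) \<le> p x" for x by (rule bound)
      \<comment> \<open>The real part of e (\<phi> x0) is f x0 = p x0, so the bound is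
        attained.\<close>
      have "p x0 \<le> norm (e (\<phi> x0))"
        using complex_Re_le_cmod[of "e (\<phi> x0)"] by (simp add: e\<phi> f(3))
      with bound[of x0] show "norm (\<phi> x0) = p x0" by (simp add: e_norm)
    qed
  qed
qed

text \<open>Domination by a multiple of the norm makes the functional continuous. Besides the norm,
  this is applied to the distance from a closed subspace, to \<open>orbit_norm\<close> and to
  \<open>mean_seminorm\<close>.\<close>

lemma Hahn_Banach_dual:
  assumes p: "seminorm p" and C: "\<And>x. p x \<le> C * norm x"
  obtains \<phi> where "\<phi> \<in> dual_space smul" "\<And>x. norm (\<phi> x) \<le> p x" "norm (\<phi> x0) = p x0"
proof -
  obtain \<phi> where \<phi>: "Vector_Spaces.linear smul (*) \<phi>" "\<And>x. norm (\<phi> x) \<le> p x" "norm (\<phi> x0) = p x0"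
    using Hahn_Banach_seminorm[OF p] by blast
  have "bounded_linear \<phi>"
  proof (rule bounded_linear_intro)
    show "\<phi> (x + y) = \<phi> x + \<phi> y" for x y
      using \<phi>(1) by (simp add: Vector_Spaces.linear_iff)
    show "\<phi> (r *\<^sub>R x) = r *\<^sub>R \<phi> x" for r x
      using \<phi>(1) scale_of_real[of r x]
      by (metis Vector_Spaces.linear_iff scaleR_conv_of_real)
    show "norm (\<phi> x) \<le> norm x * C" for x
      using \<phi>(2)[of x] C[of x] by (simp add: mult.commute)
  qed
  with \<phi> show thesis
    by (intro that[of \<phi>]) (auto simp: dual_space_def)
qed

text \<open>A norming functional of v - w separates the two vectors. This gives the uniqueness
  behind \<open>rho_mu\<close> and reduces its algebraic laws to laws of scalar integrals.\<close>

lemma dual_space_eqI: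
  assumes "\<And>\<phi>. \<phi> \<in> dual_space smul \<Longrightarrow> \<phi> v = \<phi> w"
  shows "v = w"
proof -
  obtain \<phi> where \<phi>: "\<phi> \<in> dual_space smul" "norm (\<phi> (v - w)) = norm (v - w)"
    using Hahn_Banach_dual[OF seminorm_norm, of 1 "v - w"] by (metis mult_1 order_refl)
  then have "\<phi> (v - w) = 0"
    using assms[OF \<phi>(1)] linear_diff[OF bounded_linear.linear[OF bounded_linear_dual_space[OF \<phi>(1)]], of v w]
    by simp
  with \<phi>(2) show ?thesis by simp
qed

text \<open>The dominating seminorm is the distance to W: it vanishes on W, it is at most the norm,
  and it is positive at \<open>x0\<close> because W is closed.\<close>

lemma dual_space_annihilator:
  assumes W: "subspace W" "closed W" and x0: "x0 \<notin> W"
  obtains \<phi> where "\<phi> \<in> dual_space smul" "\<And>w. w \<in> W \<Longrightarrow> \<phi> w = 0" "\<phi> x0 \<noteq> 0"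
proof -
  let ?p = "\<lambda>x. infdist x W"
  have ne: "W \<noteq> {}" using subspace_0[OF W(1)] by blast
  have p_le: "?p x \<le> norm (x - w)" if "w \<in> W" for x w
    using infdist_le[OF that] by (simp add: dist_norm)
  have p_ge: "d \<le> ?p x" if "\<And>w. w \<in> W \<Longrightarrow> d \<le> norm (x - w)" for d x
    unfolding infdist_notempty[OF ne] by (rule cINF_greatest[OF ne]) (use that in \<open>simp add: dist_norm\<close>)
  have "seminorm ?p"
  proof (rule seminormI)
    fix x y
    \<comment> \<open>Competitors v and w for the two distances are fixed; the infima over v and
      then over w follow.\<close>
    have *: "?p (x + y) \<le> norm (x - v) + norm (y - w)" if "v \<in> W" "w \<in> W" for v w
      using p_le[OF subspace_add[OF W(1) that], of "x + y"] norm_triangle_ineq[of "x - v" "y - w"]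
      by (simp add: algebra_simps)
    have "?p (x + y) - norm (y - w) \<le> ?p x" if "w \<in> W" for w
      by (rule p_ge) (use *[OF _ that] in \<open>simp add: algebra_simps\<close>)
    then have "?p (x + y) - ?p x \<le> ?p y"
      by (intro p_ge) (simp add: algebra_simps)
    then show "?p (x + y) \<le> ?p x + ?p y" by simp
  next
    show "?p 0 = 0" using subspace_0[OF W(1)] by simp
  next
    fix c :: 'k and x assume c: "c \<noteq> 0"
    have "?p (smul c x) / norm c \<le> ?p x"
    proof (rule p_ge)
      fix w assume "w \<in> W"
      then have "?p (smul c x) \<le> norm c * norm (x - w)"
        using p_le[OF subspace_scale[OF W(1), of w c], of "smul c x"]
        by (simp add: scale_right_diff_distrib[symmetric] norm_scale)
      then show "?p (smul c x) / norm c \<le> norm (x - w)" using c by (simp add: field_simps)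
    qed
    with c show "?p (smul c x) \<le> norm c * ?p x" by (simp add: field_simps)
  qed
  moreover have "?p x \<le> 1 * norm x" for x
    using p_le[OF subspace_0[OF W(1)], of x] by simp
  ultimately obtain \<phi> where \<phi>: "\<phi> \<in> dual_space smul" "\<And>x. norm (\<phi> x) \<le> ?p x" "norm (\<phi> x0) = ?p x0"
    using Hahn_Banach_dual[of ?p 1 x0] by blast
  show thesis
  proof (rule that[OF \<phi>(1)])
    show "\<phi> w = 0" if "w \<in> W" for w using \<phi>(2)[of w] that by simp
    have "?p x0 \<noteq> 0" using x0 W(2) ne by (simp add: in_closed_iff_infdist_zero)
    with \<phi>(3) show "\<phi> x0 \<noteq> 0" by auto
  qed
qed

end


section \<open>Uniformly bounded modules and Cesaro means\<close>

text \<open>The Baire sets are generated by real-valued functions, whereas the orbit maps take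
  values in the scalar field. In a metric space an open set is the locus where the distance to its
  complement is non-zero, and this distance composed with f is real-valued and continuous.\<close>

lemma borel_measurable_baire:
  fixes f :: "'a \<Rightarrow> 'b::metric_space"
  assumes M: "space M = topspace X" "sets M = baire_sets X" and f: "continuous_map X euclidean f"
  shows "f \<in> borel_measurable M"
proof (rule borel_measurableI)
  fix U :: "'b set" assume U: "open U"
  show "f -` U \<inter> space M \<in> sets M"
  \<comment> \<open>The distance to the empty set is 0 by convention, so the whole space is treated
    separately.\<close>
  proof (cases "U = UNIV")
    case True
    then show ?thesis by simp
  next
    case False
    define d where "d x = infdist (f x) (- U)" for x
    have "continuous_map euclidean euclideanreal (\<lambda>y. infdist y (- U))"
      by (simp add: continuous_on_infdist continuous_on_id)
    from continuous_map_compose[OF f this] have "continuous_map X euclideanreal d"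
      by (simp add: d_def[abs_def] o_def)
    moreover have "f -` U \<inter> space M = d -` (- {0}) \<inter> topspace X"
    proof -
      have "- U \<noteq> {}" "closed (- U)" using U False by auto
      then have "y \<in> U \<longleftrightarrow> infdist y (- U) \<noteq> 0" for y
        using in_closed_iff_infdist_zero[of "- U" y] by auto
      then show ?thesis by (auto simp: M(1) d_def)
    qed
    ultimately show ?thesis
      unfolding M(2) baire_sets_def
      by (intro sigma_sets.Basic CollectI exI[of _ d] exI[of _ "- {0}"] conjI) auto
  qed
qed

section \<open>Cesaro means of a linear operator\<close>

definition cesaro_mean :: "('v::real_vector \<Rightarrow> 'v) \<Rightarrow> nat \<Rightarrow> 'v \<Rightarrow> 'v" where
  "cesaro_mean T m v = (1 / real m) *\<^sub>R (\<Sum>k<m. (T ^^ k) v)"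

lemma linear_funpow: "linear T \<Longrightarrow> linear (T ^^ k)" for T :: "'v::real_vector \<Rightarrow> 'v"
proof (induction k)
  case 0
  show ?case by (simp add: id_def linear_id[unfolded id_def])
next
  case (Suc k)
  then show ?case using linear_compose[of "T ^^ k" T] by (simp add: o_def)
qed

lemma linear_cesaro_mean: "linear T \<Longrightarrow> linear (cesaro_mean T m)"
  unfolding cesaro_mean_def
  by (intro linear_compose_scale_right linear_compose_sum ballI linear_funpow)

text \<open>The sum telescopes. When the powers of T are bounded, the right-hand side is of order 1
  / m, and all convergence to 0 below rests on this rate.\<close>

lemma cesaro_mean_diff:
  assumes "linear T"
  shows "cesaro_mean T m (v - T v) = (1 / real m) *\<^sub>R (v - (T ^^ m) v)"
proof -
  have "(\<Sum>k<m. (T ^^ k) (v - T v)) = (\<Sum>k<m. (T ^^ k) v - (T ^^ Suc k) v)"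
    by (intro sum.cong refl) (simp add: linear_diff[OF linear_funpow[OF assms]] funpow_swap1)
  also have "\<dots> = v - (T ^^ m) v"
    by (subst sum_lessThan_telescope') simp
  finally show ?thesis by (simp add: cesaro_mean_def)
qed

lemma cesaro_mean_fixed: "T v = v \<Longrightarrow> 0 < m \<Longrightarrow> cesaro_mean T m v = v"
proof -
  assume "T v = v" "0 < m"
  then have "(T ^^ k) v = v" for k by (induction k) auto
  then show ?thesis using \<open>0 < m\<close> by (simp add: cesaro_mean_def scaleR_conv_of_real sum_constant_scaleR)
qed

lemma cesaro_mean_fixed_tendsto:
  fixes v :: "'v::real_normed_vector"
  assumes "T v = v"
  shows "(\<lambda>m. cesaro_mean T m v) \<longlonglongrightarrow> v"
proof (rule tendsto_eventually)
  show "eventually (\<lambda>m. cesaro_mean T m v = v) sequentially"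
    using eventually_gt_at_top[of 0] by eventually_elim (simp add: cesaro_mean_fixed assms)
qed

section \<open>The invariant norm of a uniformly bounded module\<close>

locale bounded_module = banach_space_over smul
  for smul :: "'k::real_or_complex \<Rightarrow> 'v::banach \<Rightarrow> 'v" +
  fixes \<rho> :: "'g::topological_group_add \<Rightarrow> 'v \<Rightarrow> 'v"
  assumes uniformly_bounded: "uniformly_bounded_module smul UNIV \<rho>"
begin

lemma bounded_linear_rho: "bounded_linear (\<rho> g)"
  and rho_smul: "\<rho> g (smul c v) = smul c (\<rho> g v)"
  using uniformly_bounded by (auto simp: uniformly_bounded_module_def GL_def Vector_Spaces.linear_iff)

lemma linear_rho: "linear (\<rho> g)"
  using bounded_linear_rho by (rule bounded_linear.linear)

lemma rho_plus: "\<rho> (g + h) v = \<rho> g (\<rho> h v)"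
  using uniformly_bounded by (simp add: uniformly_bounded_module_def)

text \<open>The homomorphism law makes \<open>\<rho> 0\<close> idempotent, and an injective
  idempotent map is the identity.\<close>

lemma rho_zero: "\<rho> 0 v = v"
proof -
  have "inj (\<rho> 0)"
    using uniformly_bounded by (auto simp: uniformly_bounded_module_def GL_def bij_def)
  moreover have "\<rho> 0 (\<rho> 0 v) = \<rho> 0 v"
    using rho_plus[of 0 0 v] by simp
  ultimately show ?thesis by (simp add: inj_eq)
qed

definition rho_bound :: real where
  "rho_bound = (SUP g. onorm (\<rho> g))"

lemma norm_rho_le: "norm (\<rho> g v) \<le> rho_bound * norm v"
proof -
  have "onorm (\<rho> g) \<le> rho_bound"
    unfolding rho_bound_def
    using uniformly_bounded by (intro cSUP_upper) (auto simp: uniformly_bounded_module_def)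
  then show ?thesis
    using onorm[OF bounded_linear_rho, of g v] by (meson mult_right_mono norm_ge_zero order_trans)
qed

lemma rho_bound_nonneg: "0 \<le> rho_bound"
proof -
  have "onorm (\<rho> 0) \<le> rho_bound"
    unfolding rho_bound_def
    using uniformly_bounded by (intro cSUP_upper) (auto simp: uniformly_bounded_module_def)
  with onorm_pos_le[OF bounded_linear_rho[of 0]] show ?thesis by simp
qed

text \<open>An equivalent norm, lying between the norm and \<open>rho_bound\<close> times the norm.
  Averages of the operators \<open>\<rho> g\<close> are contractions for it, so arbitrarily long
  products of averages cost only a single factor \<open>rho_bound\<close> in the original
  norm.\<close>

definition orbit_norm :: "'v \<Rightarrow> real" where
  "orbit_norm v = (SUP g. norm (\<rho> g v))"

lemma norm_rho_le_orbit_norm: "norm (\<rho> g v) \<le> orbit_norm v"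
  unfolding orbit_norm_def
  by (rule cSUP_upper) (auto intro!: bdd_aboveI2[of _ _ "rho_bound * norm v"] norm_rho_le)

lemma orbit_norm_le: "(\<And>g. norm (\<rho> g v) \<le> c) \<Longrightarrow> orbit_norm v \<le> c"
  unfolding orbit_norm_def by (rule cSUP_least) auto

lemma norm_le_orbit_norm: "norm v \<le> orbit_norm v"
  using norm_rho_le_orbit_norm[of 0 v] by (simp add: rho_zero)

lemma orbit_norm_le_norm: "orbit_norm v \<le> rho_bound * norm v"
  by (rule orbit_norm_le) (rule norm_rho_le)

lemma orbit_norm_rho_le: "orbit_norm (\<rho> g v) \<le> orbit_norm v"
  by (rule orbit_norm_le) (simp add: rho_plus[symmetric] norm_rho_le_orbit_norm)

lemma orbit_norm_nonneg: "0 \<le> orbit_norm v"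
  using norm_le_orbit_norm[of v] norm_ge_zero[of v] by linarith

lemma orbit_norm_add: "orbit_norm (v + w) \<le> orbit_norm v + orbit_norm w"
proof (rule orbit_norm_le)
  fix g
  show "norm (\<rho> g (v + w)) \<le> orbit_norm v + orbit_norm w"
    using norm_triangle_ineq[of "\<rho> g v" "\<rho> g w"] norm_rho_le_orbit_norm[of g v]
      norm_rho_le_orbit_norm[of g w]
    by (simp add: linear_add[OF linear_rho])
qed

lemma orbit_norm_0: "orbit_norm 0 = 0"
  using orbit_norm_le_norm[of 0] orbit_norm_nonneg[of 0] by simp

lemma seminorm_orbit_norm: "seminorm orbit_norm"
proof (rule seminormI)
  show "orbit_norm (smul c x) \<le> norm c * orbit_norm x" for c x
    by (rule orbit_norm_le)
      (simp add: rho_smul norm_scale mult_left_mono norm_rho_le_orbit_norm)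
qed (auto simp: orbit_norm_add orbit_norm_0)

lemma orbit_norm_smul: "orbit_norm (smul c v) = norm c * orbit_norm v"
  using seminorm_orbit_norm by (simp add: seminorm_def)

lemma orbit_norm_scaleR: "orbit_norm (r *\<^sub>R v) = \<bar>r\<bar> * orbit_norm v"
  using orbit_norm_smul[of "of_real r" v] by (simp add: scale_of_real)

lemma orbit_norm_minus: "orbit_norm (- v) = orbit_norm v"
  using orbit_norm_scaleR[of "-1" v] by simp

lemma orbit_norm_diff: "orbit_norm (v - w) \<le> orbit_norm v + orbit_norm w"
  using orbit_norm_add[of v "- w"] by (simp add: orbit_norm_minus)

lemma orbit_norm_sum: "orbit_norm (\<Sum>i\<in>I. f i) \<le> (\<Sum>i\<in>I. orbit_norm (f i))"
proof (induction I rule: infinite_finite_induct)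
  case (insert x F)
  then show ?case using orbit_norm_add[of "f x" "sum f F"] by simp
qed (auto simp: orbit_norm_0)

lemma smul_scaleR: "smul c (r *\<^sub>R v) = r *\<^sub>R smul c v"
  by (metis scale_of_real scale_left_commute)

lemma bounded_linear_image_closure:
  assumes "bounded_linear T" "T ` A \<subseteq> A" "v \<in> closure A"
  shows "T v \<in> closure A"
proof -
  have "T ` closure A \<subseteq> closure A"
  proof (rule image_closure_subset)
    show "continuous_on (closure A) T"
      using assms(1) by (rule bounded_linear.continuous_on) (rule continuous_on_id)
    show "T ` A \<subseteq> closure A" using assms(2) closure_subset by (rule subset_trans)
  qed simp
  with assms(3) show ?thesis by blast
qed

lemma bounded_linear_smul: "bounded_linear (smul c)"
  by (rule bounded_linear_intro[where K = "norm c"])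
    (auto simp: scale_right_distrib smul_scaleR norm_scale)

lemma subspace_closure:
  assumes "subspace W"
  shows "subspace (closure W)"
proof (rule subspaceI)
  show "0 \<in> closure W" using subspace_0[OF assms] closure_subset by blast
  show "x + y \<in> closure W" if "x \<in> closure W" "y \<in> closure W" for x y
  proof -
    obtain a b where "\<And>n. a n \<in> W" "a \<longlonglongrightarrow> x" "\<And>n. b n \<in> W" "b \<longlonglongrightarrow> y"
      using \<open>x \<in> closure W\<close> \<open>y \<in> closure W\<close> unfolding closure_sequential by blast
    then show ?thesis
      unfolding closure_sequential
      by (intro exI[of _ "\<lambda>n. a n + b n"]) (auto intro: tendsto_add subspace_add[OF assms])
  qed
  show "smul c x \<in> closure W" if "x \<in> closure W" for c x
    by (rule bounded_linear_image_closure[OF bounded_linear_smul _ that])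
      (auto intro: subspace_scale[OF assms])
qed

end

text \<open>Interpreted twice: with T = \<open>rho_mu\<close> for the ergodic decomposition, and
  with T = \<open>\<rho> z\<close> for a single central z.\<close>

locale orbit_contraction = bounded_module smul \<rho>
  for smul :: "'k::real_or_complex \<Rightarrow> 'v::banach \<Rightarrow> 'v"
    and \<rho> :: "'g::topological_group_add \<Rightarrow> 'v \<Rightarrow> 'v" +
  fixes T :: "'v \<Rightarrow> 'v"
  assumes linear_T: "linear T" and contraction: "orbit_norm (T v) \<le> orbit_norm v"
begin

lemma orbit_norm_funpow: "orbit_norm ((T ^^ k) v) \<le> orbit_norm v"
  by (induction k) (auto intro: order_trans contraction)

lemma orbit_norm_cesaro_mean: "orbit_norm (cesaro_mean T m v) \<le> orbit_norm v"
proof (cases "m = 0")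
  case False
  have "orbit_norm (\<Sum>k<m. (T ^^ k) v) \<le> (\<Sum>k<m. orbit_norm ((T ^^ k) v))"
    by (rule orbit_norm_sum)
  also have "\<dots> \<le> (\<Sum>k<m. orbit_norm v)"
    by (intro sum_mono orbit_norm_funpow)
  finally show ?thesis
    using False by (simp add: cesaro_mean_def orbit_norm_scaleR field_simps)
qed (simp add: cesaro_mean_def orbit_norm_0 orbit_norm_nonneg)

lemma orbit_norm_cesaro_mean_diff:
  "orbit_norm (cesaro_mean T m (v - T v)) \<le> 2 * orbit_norm v / real m"
  using orbit_norm_diff[of v "(T ^^ m) v"] orbit_norm_funpow[of m v]
  by (simp add: cesaro_mean_diff[OF linear_T] orbit_norm_scaleR divide_right_mono)

lemma norm_cesaro_mean_le: "norm (cesaro_mean T m v) \<le> rho_bound * norm v"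
  using norm_le_orbit_norm orbit_norm_cesaro_mean orbit_norm_le_norm by (meson order_trans)

text \<open>Replace v by a nearby w - T w. The means of the latter are of order 1 / m, and those of
  the error stay small uniformly in m.\<close>

lemma cesaro_mean_tendsto_0:
  assumes "v \<in> closure (range (\<lambda>v. v - T v))"
  shows "(\<lambda>m. cesaro_mean T m v) \<longlonglongrightarrow> 0"
proof (rule LIMSEQ_I)
  fix e :: real assume e: "0 < e"
  \<comment> \<open>Adding 1 makes the constant positive, since \<open>rho_bound\<close> is only
    known to be nonnegative.\<close>
  define C where "C = rho_bound + 1"
  have C: "0 < C" "rho_bound \<le> C" using rho_bound_nonneg by (auto simp: C_def)
  obtain w where w: "norm (v - (w - T w)) < e / (2 * C)"
    using assms e C unfolding closure_approachable
    by (auto simp: dist_norm norm_minus_commute dest!: spec[of _ "e / (2 * C)"])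
  obtain M where M: "4 * orbit_norm w / e < real M"
    using reals_Archimedean2 by blast
  show "\<exists>N. \<forall>m\<ge>N. norm (cesaro_mean T m v - 0) < e"
  proof (intro exI[of _ "Suc M"] allI impI)
    fix m assume m: "Suc M \<le> m"
    have "norm (cesaro_mean T m (w - T w)) \<le> 2 * orbit_norm w / real m"
      using norm_le_orbit_norm orbit_norm_cesaro_mean_diff by (rule order_trans)
    also have "\<dots> < e / 2"
    proof -
      have "4 * orbit_norm w / e < real m" using M m by linarith
      then show ?thesis using e m by (simp add: field_simps)
    qed
    finally have 1: "norm (cesaro_mean T m (w - T w)) < e / 2" .
    have "norm (cesaro_mean T m (v - (w - T w))) \<le> C * norm (v - (w - T w))"
      using norm_cesaro_mean_le C(2) by (meson mult_right_mono norm_ge_zero order_trans)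
    also have "\<dots> < e / 2" using w C(1) by (simp add: field_simps)
    finally have "norm (cesaro_mean T m (v - (w - T w)) + cesaro_mean T m (w - T w)) < e"
      using 1 by norm
    then show "norm (cesaro_mean T m v - 0) < e"
      by (simp add: linear_add[OF linear_cesaro_mean[OF linear_T], symmetric])
  qed
qed

text \<open>The means are bounded uniformly in m, so the Cauchy property passes to limits by an e /
  3 argument. Closedness is what allows a functional to separate a point from this set.\<close>

lemma closed_convergent_cesaro_mean: "closed {v. convergent (\<lambda>m. cesaro_mean T m v)}"
  unfolding closed_sequential_limits
proof (intro allI impI)
  fix x l
  assume "(\<forall>n. x n \<in> {v. convergent (\<lambda>m. cesaro_mean T m v)}) \<and> x \<longlonglongrightarrow> l"
  then have x: "\<And>n. Cauchy (\<lambda>m. cesaro_mean T m (x n))" "x \<longlonglongrightarrow> l"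
    by (auto intro: convergent_Cauchy)
  have "Cauchy (\<lambda>m. cesaro_mean T m l)"
  proof (rule CauchyI)
    fix e :: real assume e: "0 < e"
    define C where "C = rho_bound + 1"
    have C: "0 < C" "rho_bound \<le> C" using rho_bound_nonneg by (auto simp: C_def)
    obtain n where n: "norm (x n - l) < e / (3 * C)"
      using LIMSEQ_D[OF x(2), of "e / (3 * C)"] e C by auto
    have close: "norm (cesaro_mean T m (x n - l)) < e / 3" for m
    proof -
      have "norm (cesaro_mean T m (x n - l)) \<le> C * norm (x n - l)"
        using norm_cesaro_mean_le C(2) by (meson mult_right_mono norm_ge_zero order_trans)
      also have "\<dots> < e / 3" using n C(1) by (simp add: field_simps)
      finally show ?thesis .
    qed
    obtain M where M: "\<And>m k. M \<le> m \<Longrightarrow> M \<le> k \<Longrightarrow>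
        norm (cesaro_mean T m (x n) - cesaro_mean T k (x n)) < e / 3"
      using CauchyD[OF x(1)[of n], of "e / 3"] e by auto
    show "\<exists>M. \<forall>m\<ge>M. \<forall>k\<ge>M. norm (cesaro_mean T m l - cesaro_mean T k l) < e"
    proof (intro exI[of _ M] allI impI)
      fix m k assume "M \<le> m" "M \<le> k"
      then have "norm (cesaro_mean T m (x n) - cesaro_mean T k (x n)) < e / 3" by (rule M)
      with close[of m] close[of k] show "norm (cesaro_mean T m l - cesaro_mean T k l) < e"
        unfolding linear_diff[OF linear_cesaro_mean[OF linear_T]] by norm
    qed
  qed
  then show "l \<in> {v. convergent (\<lambda>m. cesaro_mean T m v)}"
    by (simp add: Cauchy_convergent)
qed

end


section \<open>The mean ergodic decomposition\<close>

locale stationary_module = bounded_module smul \<rho>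
  for smul :: "'k::real_or_complex \<Rightarrow> 'v::banach \<Rightarrow> 'v"
    and \<rho> :: "'g::topological_group_add \<Rightarrow> 'v \<Rightarrow> 'v" +
  fixes \<mu> :: "'g measure"
  assumes baire: "\<mu> \<in> baire_prob_measures (top_of_set group_center)"
    and strongly_continuous: "strongly_operator_continuous UNIV \<rho>"
    and stationary: "weakly_uniquely_stationary smul group_center \<mu> \<rho>"
begin

lemma space_mu: "space \<mu> = group_center"
  and prob_space_mu: "prob_space \<mu>"
  using baire by (auto simp: baire_prob_measures_def)

lemma continuous_on_rho: "continuous_on S (\<lambda>g. \<rho> g v)"
  using strongly_continuous continuous_on_subset[of UNIV "\<lambda>g. \<rho> g v" S]
  by (simp add: strongly_operator_continuous_def)

text \<open>The integral is a total function with default value 0, so additivity and the comparison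
  of integrals can be used only once integrability is known. It holds because the integrand is
  continuous, hence Baire measurable, and bounded.\<close>

lemma integrable_orbit:
  assumes \<phi>: "\<phi> \<in> dual_space smul"
  shows "integrable \<mu> (\<lambda>z. \<phi> (\<rho> z v))"
proof (rule finite_measure.integrable_const_bound)
  show "finite_measure \<mu>"
    using prob_space_mu by (rule prob_space.finite_measure)
  have \<phi>': "bounded_linear \<phi>" using \<phi> by (rule bounded_linear_dual_space)
  show "(\<lambda>z. \<phi> (\<rho> z v)) \<in> borel_measurable \<mu>"
  proof (rule borel_measurable_baire)
    show "space \<mu> = topspace (top_of_set group_center)" by (simp add: space_mu)
    show "sets \<mu> = baire_sets (top_of_set group_center)"
      using baire by (auto simp: baire_prob_measures_def)
    show "continuous_map (top_of_set group_center) euclidean (\<lambda>z. \<phi> (\<rho> z v))"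
      by (simp add: bounded_linear.continuous_on[OF \<phi>'] continuous_on_rho)
  qed
  show "AE z in \<mu>. norm (\<phi> (\<rho> z v)) \<le> onorm \<phi> * orbit_norm v"
  proof (rule AE_I2)
    fix z
    have "norm (\<phi> (\<rho> z v)) \<le> onorm \<phi> * norm (\<rho> z v)" by (rule onorm[OF \<phi>'])
    also have "\<dots> \<le> onorm \<phi> * orbit_norm v"
      by (rule mult_left_mono[OF norm_rho_le_orbit_norm onorm_pos_le[OF \<phi>']])
    finally show "norm (\<phi> (\<rho> z v)) \<le> onorm \<phi> * orbit_norm v" .
  qed
qed

abbreviation R :: "'v \<Rightarrow> 'v" where
  "R \<equiv> rho_mu smul \<mu> \<rho>"

text \<open>Integrability of the module provides a vector and \<open>dual_space_eqI\<close> its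
  uniqueness; together they discharge the definite description in \<open>rho_mu\<close>.\<close>

lemma dual_rho_mu:
  assumes "\<phi> \<in> dual_space smul"
  shows "\<phi> (R v) = (\<integral>z. \<phi> (\<rho> z v) \<partial>\<mu>)"
proof -
  obtain w where w: "\<forall>\<phi>\<in>dual_space smul. \<phi> w = (\<integral>z. \<phi> (\<rho> z v) \<partial>\<mu>)"
    using stationary unfolding weakly_uniquely_stationary_def mu_integrable_def by blast
  have "\<forall>\<phi>\<in>dual_space smul. \<phi> (R v) = (\<integral>z. \<phi> (\<rho> z v) \<partial>\<mu>)"
    unfolding rho_mu_def
  proof (rule theI[of _ w])
    show "w' = w" if "\<forall>\<phi>\<in>dual_space smul. \<phi> w' = (\<integral>z. \<phi> (\<rho> z v) \<partial>\<mu>)" for w'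
      by (rule dual_space_eqI) (use w that in auto)
  qed (rule w)
  with assms show ?thesis by blast
qed

lemma dual_space_add: "\<phi> \<in> dual_space smul \<Longrightarrow> \<phi> (v + w) = \<phi> v + \<phi> w"
  and dual_space_smul: "\<phi> \<in> dual_space smul \<Longrightarrow> \<phi> (smul c v) = c * \<phi> v"
  by (auto simp: dual_space_def Vector_Spaces.linear_iff)

lemma dual_space_compose_rho:
  assumes "\<phi> \<in> dual_space smul"
  shows "(\<lambda>v. \<phi> (\<rho> g v)) \<in> dual_space smul"
  using assms bounded_linear_compose[OF bounded_linear_dual_space[OF assms] bounded_linear_rho[of g]]
  by (auto simp: dual_space_def Vector_Spaces.linear_iff rho_smul linear_add[OF linear_rho])

lemma rho_mu_add: "R (v + w) = R v + R w"
  by (rule dual_space_eqI)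
    (simp add: dual_rho_mu dual_space_add linear_add[OF linear_rho] integrable_orbit)

lemma rho_mu_smul: "R (smul c v) = smul c (R v)"
  by (rule dual_space_eqI) (simp add: dual_rho_mu dual_space_smul rho_smul)

lemma linear_rho_mu: "linear R"
  by (rule linearI) (simp_all add: rho_mu_add rho_mu_smul flip: scale_of_real)

text \<open>The functional \<phi> composed with \<open>\<rho> g\<close> is again in the dual, and
  since \<mu> lives on the centre, g can be moved past z inside the integral.\<close>

lemma rho_mu_rho: "R (\<rho> g v) = \<rho> g (R v)"
proof (rule dual_space_eqI)
  fix \<phi> assume \<phi>: "\<phi> \<in> dual_space smul"
  have "\<phi> (\<rho> g (R v)) = (\<integral>z. \<phi> (\<rho> g (\<rho> z v)) \<partial>\<mu>)"
    by (rule dual_rho_mu[OF dual_space_compose_rho[OF \<phi>]])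
  also have "\<dots> = (\<integral>z. \<phi> (\<rho> z (\<rho> g v)) \<partial>\<mu>)"
    by (rule Bochner_Integration.integral_cong)
      (auto simp: space_mu group_center_def simp flip: rho_plus)
  finally show "\<phi> (R (\<rho> g v)) = \<phi> (\<rho> g (R v))"
    by (simp add: dual_rho_mu[OF \<phi>])
qed

text \<open>\<open>rho_mu\<close> is defined weakly, so the estimate is made for a functional that
  is dominated by \<open>orbit_norm\<close> and attains it at R v.\<close>

lemma orbit_norm_rho_mu: "orbit_norm (R v) \<le> orbit_norm v"
proof -
  interpret prob_space \<mu> by (rule prob_space_mu)
  obtain \<phi> where \<phi>: "\<phi> \<in> dual_space smul" "\<And>x. norm (\<phi> x) \<le> orbit_norm x"
    "norm (\<phi> (R v)) = orbit_norm (R v)"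
    using Hahn_Banach_dual[OF seminorm_orbit_norm orbit_norm_le_norm] by blast
  have "norm (\<integral>z. \<phi> (\<rho> z v) \<partial>\<mu>) \<le> (\<integral>z. norm (\<phi> (\<rho> z v)) \<partial>\<mu>)"
    by (rule integral_norm_bound)
  also have "\<dots> \<le> (\<integral>z. orbit_norm v \<partial>\<mu>)"
    by (intro integral_mono integrable_norm integrable_orbit \<phi>(1) integrable_const)
      (rule order_trans[OF \<phi>(2) orbit_norm_rho_le])
  finally show ?thesis
    by (simp add: \<phi>(3)[symmetric] dual_rho_mu[OF \<phi>(1)] prob_space)
qed

sublocale orbit_contraction smul \<rho> R
  by unfold_locales (simp_all add: rho_mu_add linear_cmul[OF linear_rho_mu] orbit_norm_rho_mu)

abbreviation V0 :: "'v set" where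
  "V0 \<equiv> closure (range (Delta_mu smul \<mu> \<rho>))"

abbreviation Vmu :: "'v set" where
  "Vmu \<equiv> mu_fixed smul \<mu> \<rho>"

lemma Delta_mu_eq: "Delta_mu smul \<mu> \<rho> = (\<lambda>v. v - R v)"
  by (simp add: fun_eq_iff Delta_mu_def)

lemma bounded_linear_rho_mu: "bounded_linear R"
proof (rule bounded_linear_intro)
  show "norm (R x) \<le> norm x * rho_bound" for x
    using norm_le_orbit_norm[of "R x"] orbit_norm_rho_mu[of x] orbit_norm_le_norm[of x]
    by (simp add: mult.commute)
qed (auto simp: linear_add[OF linear_rho_mu] linear_cmul[OF linear_rho_mu])

lemma subspace_range_Delta: "subspace (range (Delta_mu smul \<mu> \<rho>))"
  unfolding Delta_mu_eq
proof (rule subspaceI)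
  show "0 \<in> range (\<lambda>v. v - R v)"
    by (rule range_eqI[of _ _ 0]) (simp add: linear_0[OF linear_rho_mu])
  fix x y assume "x \<in> range (\<lambda>v. v - R v)" "y \<in> range (\<lambda>v. v - R v)"
  then obtain a b where "x = a - R a" "y = b - R b" by blast
  then show "x + y \<in> range (\<lambda>v. v - R v)"
    by (intro range_eqI[of _ _ "a + b"]) (simp add: rho_mu_add)
next
  fix c x assume "x \<in> range (\<lambda>v. v - R v)"
  then obtain a where "x = a - R a" by blast
  then show "smul c x \<in> range (\<lambda>v. v - R v)"
    by (intro range_eqI[of _ _ "smul c a"]) (simp add: rho_mu_smul scale_right_diff_distrib)
qed

lemma subspace_V0: "subspace V0"
  by (rule subspace_closure[OF subspace_range_Delta])

lemma rho_V0: "v \<in> V0 \<Longrightarrow> \<rho> g v \<in> V0"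
proof (rule bounded_linear_image_closure[OF bounded_linear_rho])
  show "\<rho> g ` range (Delta_mu smul \<mu> \<rho>) \<subseteq> range (Delta_mu smul \<mu> \<rho>)"
    by (auto simp: Delta_mu_eq linear_diff[OF linear_rho] simp flip: rho_mu_rho)
qed

text \<open>The vectors with convergent means form a closed subspace W containing every x - R x and
  every fixed vector. A functional annihilating W but not v would be stationary and non-zero, hence
  non-zero at some fixed vector, which lies in W.\<close>

lemma convergent_cesaro_mean: "convergent (\<lambda>m. cesaro_mean R m v)"
proof (rule ccontr)
  let ?W = "{v. convergent (\<lambda>m. cesaro_mean R m v)}"
  note cesaro_linear = linear_cesaro_mean[OF linear_rho_mu]
  assume v: "\<not> convergent (\<lambda>m. cesaro_mean R m v)"
  have cesaro_smul: "cesaro_mean R m (smul c x) = smul c (cesaro_mean R m x)" for m c x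
  proof -
    have "(R ^^ k) (smul c x) = smul c ((R ^^ k) x)" for k
      by (induction k) (auto simp: rho_mu_smul)
    then show ?thesis
      by (simp add: cesaro_mean_def scale_sum_right smul_scaleR)
  qed
  have W: "subspace ?W"
  proof (rule subspaceI)
    show "0 \<in> ?W" by (simp add: linear_0[OF cesaro_linear] convergent_const)
    show "x + y \<in> ?W" if "x \<in> ?W" "y \<in> ?W" for x y
      using that by (simp add: linear_add[OF cesaro_linear] convergent_add)
    show "smul c x \<in> ?W" if "x \<in> ?W" for c x
      using that
      by (auto simp: cesaro_smul convergent_def intro: bounded_linear.tendsto[OF bounded_linear_smul])
  qed
  obtain \<phi> where \<phi>: "\<phi> \<in> dual_space smul" "\<And>w. w \<in> ?W \<Longrightarrow> \<phi> w = 0" "\<phi> v \<noteq> 0"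
    using dual_space_annihilator[OF W closed_convergent_cesaro_mean, of v] v by auto
  have "\<phi> (R x) = \<phi> x" for x
  proof -
    have "x - R x \<in> V0" using closure_subset by (fastforce simp: Delta_mu_eq)
    then have "x - R x \<in> ?W"
      using cesaro_mean_tendsto_0[of "x - R x"] by (auto simp: Delta_mu_eq convergent_def)
    then have "\<phi> (x - R x) = 0" by (rule \<phi>(2))
    then show ?thesis
      using dual_space_add[OF \<phi>(1), of "R x" "x - R x"] by simp
  qed
  then have "\<phi> \<circ> R = \<phi>" by auto
  moreover have "\<phi> \<noteq> (\<lambda>_. 0)" using \<phi>(3) by auto
  ultimately obtain w where w: "w \<in> Vmu" "\<phi> w \<noteq> 0"
    using stationary \<phi>(1) by (auto simp: weakly_uniquely_stationary_def)
  then have "(\<lambda>m. cesaro_mean R m w) \<longlonglongrightarrow> w"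
    by (intro cesaro_mean_fixed_tendsto) (simp add: mu_fixed_def)
  then have "w \<in> ?W" by (auto simp: convergent_def)
  with \<phi>(2) w(2) show False by blast
qed

section \<open>The projection onto the fixed vectors\<close>

definition P :: "'v \<Rightarrow> 'v" where
  "P v = lim (\<lambda>m. cesaro_mean R m v)"

lemma cesaro_mean_tendsto_P: "(\<lambda>m. cesaro_mean R m v) \<longlonglongrightarrow> P v"
  using convergent_cesaro_mean[of v] by (simp add: P_def convergent_LIMSEQ_iff)

lemma P_eqI: "(\<lambda>m. cesaro_mean R m v) \<longlonglongrightarrow> w \<Longrightarrow> P v = w"
  using cesaro_mean_tendsto_P by (rule LIMSEQ_unique)

lemma P_V0: "v \<in> V0 \<Longrightarrow> P v = 0"
  using cesaro_mean_tendsto_0[of v] by (intro P_eqI) (simp add: Delta_mu_eq)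

lemma P_Vmu: "v \<in> Vmu \<Longrightarrow> P v = v"
  by (intro P_eqI cesaro_mean_fixed_tendsto) (simp add: mu_fixed_def)

lemma P_commute:
  assumes T: "bounded_linear T" and TR: "\<And>v. R (T v) = T (R v)"
  shows "P (T v) = T (P v)"
proof (rule P_eqI)
  have T': "linear T" using T by (rule bounded_linear.linear)
  have "(R ^^ k) (T v) = T ((R ^^ k) v)" for k
    by (induction k) (auto simp: TR)
  then have "cesaro_mean R m (T v) = T (cesaro_mean R m v)" for m
    by (simp add: cesaro_mean_def linear_cmul[OF T'] linear_sum[OF T'])
  then show "(\<lambda>m. cesaro_mean R m (T v)) \<longlonglongrightarrow> T (P v)"
    using bounded_linear.tendsto[OF T cesaro_mean_tendsto_P] by simp
qed

lemma P_smul: "P (smul c v) = smul c (P v)"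
  by (rule P_commute[OF bounded_linear_smul]) (rule rho_mu_smul)

lemma P_rho: "P (\<rho> g v) = \<rho> g (P v)"
  by (rule P_commute[OF bounded_linear_rho]) (rule rho_mu_rho)

lemma norm_P_le: "norm (P v) \<le> rho_bound * norm v"
  by (rule Lim_norm_ubound[OF _ cesaro_mean_tendsto_P]) (simp_all add: norm_cesaro_mean_le)

lemma bounded_linear_P: "bounded_linear P"
proof (rule bounded_linear_intro)
  show "P (x + y) = P x + P y" for x y
    by (rule P_eqI) (simp add: linear_add[OF linear_cesaro_mean[OF linear_rho_mu]]
        tendsto_add cesaro_mean_tendsto_P)
  show "P (r *\<^sub>R x) = r *\<^sub>R P x" for r x
    using P_smul[of "of_real r" x] by (simp add: scale_of_real)
  show "norm (P x) \<le> norm x * rho_bound" for x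
    using norm_P_le[of x] by (simp only: mult.commute)
qed

text \<open>Before the limit is taken, v minus its mean is the average of the vectors v - (R ^^ k)
  v, each of which is a telescoping sum in the range of \<open>Delta_mu\<close>.\<close>

lemma diff_P_V0: "v - P v \<in> V0"
proof (rule closed_sequentially[OF closed_closure])
  have "v - (R ^^ k) v \<in> range (Delta_mu smul \<mu> \<rho>)" for k
  proof (induction k)
    case 0
    then show ?case using subspace_0[OF subspace_range_Delta] by simp
  next
    case (Suc k)
    have "(R ^^ k) v - R ((R ^^ k) v) \<in> range (Delta_mu smul \<mu> \<rho>)"
      by (simp add: Delta_mu_eq)
    from subspace_add[OF subspace_range_Delta Suc this] show ?case by simp
  qed
  then have sum: "(\<Sum>k<m. v - (R ^^ k) v) \<in> range (Delta_mu smul \<mu> \<rho>)" for m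
    by (rule subspace_sum[OF subspace_range_Delta])
  \<comment> \<open>The index starts at 1: the mean of length 0 is 0, and v itself need not lie in
    the range.\<close>
  have "v - cesaro_mean R (Suc m) v \<in> range (Delta_mu smul \<mu> \<rho>)" for m
  proof -
    have "v - cesaro_mean R (Suc m) v = smul (of_real (1 / real (Suc m))) (\<Sum>k<Suc m. v - (R ^^ k) v)"
      unfolding scale_of_real cesaro_mean_def sum_subtractf
      by (simp add: scaleR_diff_right sum_constant_scaleR del: sum.lessThan_Suc)
    then show ?thesis
      using subspace_scale[OF subspace_range_Delta sum[of "Suc m"]] by simp
  qed
  then show "v - cesaro_mean R (Suc m) v \<in> V0" for m
    using closure_subset by blast
  show "(\<lambda>m. v - cesaro_mean R (Suc m) v) \<longlonglongrightarrow> v - P v"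
    by (intro tendsto_diff tendsto_const LIMSEQ_Suc cesaro_mean_tendsto_P)
qed

text \<open>P kills v - R v and commutes with R.\<close>

lemma P_in_Vmu: "P v \<in> Vmu"
proof -
  have "P (v - R v) = 0"
    by (rule P_V0) (use closure_subset in \<open>fastforce simp: Delta_mu_eq\<close>)
  then have "P v = R (P v)"
    using P_commute[OF bounded_linear_rho_mu] linear_diff[OF bounded_linear.linear[OF bounded_linear_P]]
    by simp
  then show ?thesis by (simp add: mu_fixed_def)
qed

lemma subspace_Vmu: "subspace Vmu"
  by (rule subspaceI) (auto simp: mu_fixed_def rho_mu_add rho_mu_smul linear_0[OF linear_rho_mu])


section \<open>Averages over the centre\<close>

text \<open>The inductive form matters: each member is built from finitely many
  \<open>\<rho> z\<close>, so the coboundary property of f - T f can be followed along its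
  construction.\<close>

inductive_set central_means :: "('v \<Rightarrow> 'v) set" where
  central_means_rho: "z \<in> group_center \<Longrightarrow> \<rho> z \<in> central_means"
| central_means_convex: "S \<in> central_means \<Longrightarrow> T \<in> central_means \<Longrightarrow> 0 \<le> t \<Longrightarrow> t \<le> 1 \<Longrightarrow>
    (\<lambda>v. t *\<^sub>R S v + (1 - t) *\<^sub>R T v) \<in> central_means"
| central_means_compose: "S \<in> central_means \<Longrightarrow> T \<in> central_means \<Longrightarrow>
    (\<lambda>v. S (T v)) \<in> central_means"

lemma central_means_bounded_linear: "T \<in> central_means \<Longrightarrow> bounded_linear T"
  by (induction rule: central_means.induct)
    (auto intro: bounded_linear_rho bounded_linear_add bounded_linear_compose bounded_linear_const_scaleR)

lemma central_means_linear: "T \<in> central_means \<Longrightarrow> linear T"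
  using central_means_bounded_linear bounded_linear.linear by blast

lemma central_means_smul: "T \<in> central_means \<Longrightarrow> T (smul c v) = smul c (T v)"
  by (induction arbitrary: v rule: central_means.induct)
    (auto simp: rho_smul smul_scaleR scale_right_distrib)

lemma central_means_rho_commute: "T \<in> central_means \<Longrightarrow> T (\<rho> g v) = \<rho> g (T v)"
  by (induction arbitrary: v rule: central_means.induct)
    (auto simp: group_center_def linear_add[OF linear_rho] linear_cmul[OF linear_rho]
      simp flip: rho_plus)

lemma central_means_commute:
  assumes "T \<in> central_means" "S \<in> central_means"
  shows "T (S v) = S (T v)"
  using assms(2)
proof (induction arbitrary: v rule: central_means.induct)
  case (central_means_rho z)
  then show ?case by (simp add: central_means_rho_commute[OF assms(1)])
next
  case (central_means_convex A B t)
  then show ?case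
    by (simp add: linear_add[OF central_means_linear[OF assms(1)]]
        linear_cmul[OF central_means_linear[OF assms(1)]])
qed auto

lemma central_means_orbit_norm: "T \<in> central_means \<Longrightarrow> orbit_norm (T v) \<le> orbit_norm v"
proof (induction arbitrary: v rule: central_means.induct)
  case (central_means_rho z)
  then show ?case by (simp add: orbit_norm_rho_le)
next
  case (central_means_convex S T t)
  have "orbit_norm (t *\<^sub>R S v + (1 - t) *\<^sub>R T v) \<le> t * orbit_norm (S v) + (1 - t) * orbit_norm (T v)"
    using orbit_norm_add[of "t *\<^sub>R S v" "(1 - t) *\<^sub>R T v"] central_means_convex.hyps
    by (simp add: orbit_norm_scaleR)
  also have "\<dots> \<le> t * orbit_norm v + (1 - t) * orbit_norm v"
    using central_means_convex by (intro add_mono mult_left_mono) auto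
  finally show ?case by (simp add: algebra_simps)
next
  case (central_means_compose S T)
  show ?case by (rule order_trans[OF central_means_compose.IH(1) central_means_compose.IH(2)])
qed

lemma central_means_V0:
  assumes "T \<in> central_means" "v \<in> V0"
  shows "T v \<in> V0"
  using assms
proof (induction arbitrary: v rule: central_means.induct)
  case (central_means_convex S T t)
  then have "smul (of_real t) (S v) + smul (of_real (1 - t)) (T v) \<in> V0"
    by (intro subspace_add[OF subspace_V0] subspace_scale[OF subspace_V0]) auto
  then show ?case by (simp only: scale_of_real)
qed (auto intro: rho_V0)

text \<open>The index \<open>Suc m\<close> excludes the mean of no terms, which is the zero map
  rather than an average.\<close>

lemma cesaro_mean_central_means:
  assumes z: "z \<in> group_center"
  shows "cesaro_mean (\<rho> z) (Suc m) \<in> central_means"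
proof (induction m)
  case 0
  have "0 \<in> group_center" by (simp add: group_center_def)
  from central_means_rho[OF this] show ?case
    by (simp add: cesaro_mean_def[abs_def] rho_zero[abs_def] id_def)
next
  case (Suc m)
  have pow: "\<rho> z ^^ Suc k \<in> central_means" for k
  proof (induction k)
    case (Suc k)
    from central_means_compose[OF central_means_rho[OF z] Suc] show ?case
      by (simp add: o_def)
  qed (use central_means_rho[OF z] in \<open>simp add: o_def\<close>)
  \<comment> \<open>The mean of m + 2 terms weights the mean of the first m + 1 terms by (m + 1) /
    (m + 2) and the last term by 1 / (m + 2).\<close>
  let ?t = "real (Suc m) / real (Suc (Suc m))"
  have "(\<lambda>v. ?t *\<^sub>R cesaro_mean (\<rho> z) (Suc m) v + (1 - ?t) *\<^sub>R (\<rho> z ^^ Suc m) v) \<in> central_means"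
    by (intro central_means_convex Suc pow) auto
  also have "(\<lambda>v. ?t *\<^sub>R cesaro_mean (\<rho> z) (Suc m) v + (1 - ?t) *\<^sub>R (\<rho> z ^^ Suc m) v) =
      cesaro_mean (\<rho> z) (Suc (Suc m))"
  proof
    fix v
    have "1 - ?t = 1 / real (Suc (Suc m))" by (simp add: field_simps)
    then show "?t *\<^sub>R cesaro_mean (\<rho> z) (Suc m) v + (1 - ?t) *\<^sub>R (\<rho> z ^^ Suc m) v =
        cesaro_mean (\<rho> z) (Suc (Suc m)) v"
      unfolding cesaro_mean_def sum.lessThan_Suc[of _ "Suc m"] scaleR_add_right
      by simp
  qed
  finally show ?case .
qed

text \<open>The value 0 says that some average makes v as small as desired; the infimum need not be
  attained.\<close>

definition mean_seminorm :: "'v \<Rightarrow> real" where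
  "mean_seminorm v = (INF T\<in>central_means. orbit_norm (T v))"

lemma central_means_nonempty: "central_means \<noteq> {}"
  using central_means_rho[of 0] by (auto simp: group_center_def)

lemma mean_seminorm_le: "T \<in> central_means \<Longrightarrow> mean_seminorm v \<le> orbit_norm (T v)"
  unfolding mean_seminorm_def
  by (rule cINF_lower) (auto intro!: bdd_belowI2[of _ 0] orbit_norm_nonneg)

lemma mean_seminorm_ge:
  "(\<And>T. T \<in> central_means \<Longrightarrow> c \<le> orbit_norm (T v)) \<Longrightarrow> c \<le> mean_seminorm v"
  unfolding mean_seminorm_def by (rule cINF_greatest[OF central_means_nonempty])

text \<open>For subadditivity, an average S that is good for v and an average T that is good for w
  are merged into their composition. Since the averages commute, S can be applied first to v and T
  first to w, and the remaining factor is a contraction.\<close>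

lemma seminorm_mean_seminorm: "seminorm mean_seminorm"
proof (rule seminormI)
  obtain T where T: "T \<in> central_means" using central_means_nonempty by blast
  have "mean_seminorm 0 \<le> 0"
    using mean_seminorm_le[OF T, of 0] by (simp add: linear_0[OF central_means_linear[OF T]] orbit_norm_0)
  moreover have "0 \<le> mean_seminorm 0"
    by (rule mean_seminorm_ge) (rule orbit_norm_nonneg)
  ultimately show "mean_seminorm 0 = 0" by simp
next
  fix v w
  have *: "mean_seminorm (v + w) \<le> orbit_norm (S v) + orbit_norm (T w)"
    if S: "S \<in> central_means" and T: "T \<in> central_means" for S T
  proof -
    have "mean_seminorm (v + w) \<le> orbit_norm (S (T (v + w)))"
      by (rule mean_seminorm_le[OF central_means_compose[OF S T]])
    also have "S (T (v + w)) = T (S v) + S (T w)"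
      using S T by (simp add: linear_add[OF central_means_linear] central_means_commute[of S T])
    also have "orbit_norm \<dots> \<le> orbit_norm (T (S v)) + orbit_norm (S (T w))"
      by (rule orbit_norm_add)
    also have "\<dots> \<le> orbit_norm (S v) + orbit_norm (T w)"
      using S T by (intro add_mono central_means_orbit_norm)
    finally show ?thesis .
  qed
  have "mean_seminorm (v + w) - orbit_norm (T w) \<le> mean_seminorm v" if "T \<in> central_means" for T
    by (rule mean_seminorm_ge) (use *[OF _ that] in \<open>simp add: algebra_simps\<close>)
  then have "mean_seminorm (v + w) - mean_seminorm v \<le> mean_seminorm w"
    by (intro mean_seminorm_ge) (simp add: algebra_simps)
  then show "mean_seminorm (v + w) \<le> mean_seminorm v + mean_seminorm w" by simp
next
  fix c :: 'k and v assume c: "c \<noteq> 0"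
  have "mean_seminorm (smul c v) / norm c \<le> mean_seminorm v"
  proof (rule mean_seminorm_ge)
    fix T assume "T \<in> central_means"
    from mean_seminorm_le[OF this, of "smul c v"] central_means_smul[OF this]
    show "mean_seminorm (smul c v) / norm c \<le> orbit_norm (T v)"
      using c by (simp add: orbit_norm_smul field_simps)
  qed
  with c show "mean_seminorm (smul c v) \<le> norm c * mean_seminorm v"
    by (simp add: field_simps)
qed

text \<open>The Cesaro means of the single operator \<open>\<rho> z\<close> belong to
  \<open>central_means\<close> and shrink v - \<open>\<rho> z\<close> v at the rate 1 / m.\<close>

lemma mean_seminorm_diff_rho:
  assumes z: "z \<in> group_center"
  shows "mean_seminorm (v - \<rho> z v) \<le> 0"
proof (rule field_le_epsilon)
  fix e :: real assume e: "0 < e"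
  interpret z: orbit_contraction smul \<rho> "\<rho> z"
    by unfold_locales
      (simp_all add: linear_add[OF linear_rho] linear_cmul[OF linear_rho] orbit_norm_rho_le)
  obtain m where m: "2 * orbit_norm v / e < real m"
    using reals_Archimedean2 by blast
  have "mean_seminorm (v - \<rho> z v) \<le> orbit_norm (cesaro_mean (\<rho> z) (Suc m) (v - \<rho> z v))"
    by (rule mean_seminorm_le[OF cesaro_mean_central_means[OF z]])
  also have "\<dots> \<le> 2 * orbit_norm v / real (Suc m)"
    by (rule z.orbit_norm_cesaro_mean_diff)
  also have "\<dots> \<le> e"
  proof -
    have "2 * orbit_norm v / e \<le> real (Suc m)" using m by simp
    with e show ?thesis by (simp add: field_simps del: of_nat_Suc)
  qed
  finally show "mean_seminorm (v - \<rho> z v) \<le> 0 + e" by simp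
qed

text \<open>A functional bounded by \<open>mean_seminorm\<close> is constant on the orbits of the centre, so it is
  preserved by averaging over \<open>\<mu>\<close>.\<close>

lemma mean_seminorm_V0:
  assumes v: "v \<in> V0"
  shows "mean_seminorm v = 0"
proof -
  interpret prob_space \<mu> by (rule prob_space_mu)
  have id: "(\<lambda>v. v) \<in> central_means"
    using central_means_rho[of 0] by (simp add: group_center_def rho_zero[abs_def])
  have "mean_seminorm x \<le> rho_bound * norm x" for x
    using mean_seminorm_le[OF id, of x] orbit_norm_le_norm[of x] by simp
  then obtain \<phi> where \<phi>: "\<phi> \<in> dual_space smul" "\<And>x. norm (\<phi> x) \<le> mean_seminorm x"
    "norm (\<phi> v) = mean_seminorm v"
    using Hahn_Banach_dual[OF seminorm_mean_seminorm] by blast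
  interpret \<phi>: bounded_linear \<phi> by (rule bounded_linear_dual_space[OF \<phi>(1)])
  have "\<phi> (\<rho> z x) = \<phi> x" if "z \<in> group_center" for z x
    using order_trans[OF \<phi>(2)[of "x - \<rho> z x"] mean_seminorm_diff_rho[OF that, of x]]
    by (simp add: \<phi>.diff)
  then have "(\<integral>z. \<phi> (\<rho> z x) \<partial>\<mu>) = (\<integral>z. \<phi> x \<partial>\<mu>)" for x
    by (intro Bochner_Integration.integral_cong) (auto simp: space_mu)
  then have "\<phi> (R x) = \<phi> x" for x
    by (simp add: dual_rho_mu[OF \<phi>(1)] prob_space)
  then have "\<phi> (Delta_mu smul \<mu> \<rho> x) = 0" for x
    by (simp add: Delta_mu_def \<phi>.diff)
  then have "\<phi> ` range (Delta_mu smul \<mu> \<rho>) \<subseteq> {0}" by auto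
  then have "\<phi> ` V0 \<subseteq> {0}"
    by (intro image_closure_subset \<phi>.continuous_on continuous_on_id) auto
  with v \<phi>(3) show ?thesis by auto
qed

text \<open>If T is small on F, then T v still lies in V0, so some S makes T v small. The
  composition S T serves for v, and also for F because S is a contraction.\<close>

lemma central_means_uniformly_small:
  assumes "finite F" "F \<subseteq> V0" "0 < e"
  obtains T where "T \<in> central_means" "\<And>v. v \<in> F \<Longrightarrow> orbit_norm (T v) < e"
proof -
  have "\<exists>T\<in>central_means. \<forall>v\<in>F. orbit_norm (T v) < e"
    using assms(1,2)
  proof (induction F)
    case empty
    then show ?case using central_means_nonempty by auto
  next
    case (insert v F)
    then obtain T where T: "T \<in> central_means" "\<forall>v\<in>F. orbit_norm (T v) < e" by auto
    have "mean_seminorm (T v) < e"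
      using mean_seminorm_V0[OF central_means_V0[OF T(1)], of v] insert.prems assms(3) by auto
    then obtain S where S: "S \<in> central_means" "orbit_norm (S (T v)) < e"
      using mean_seminorm_ge[of e "T v"] by force
    show ?case
    proof (intro bexI[of _ "\<lambda>x. S (T x)"] ballI)
      show "(\<lambda>x. S (T x)) \<in> central_means" by (rule central_means_compose[OF S(1) T(1)])
      fix x assume "x \<in> insert v F"
      then show "orbit_norm (S (T x)) < e"
        using S(2) T(2) central_means_orbit_norm[OF S(1), of "T x"] by fastforce
    qed
  qed
  with that show thesis by blast
qed

text \<open>The averages are equicontinuous, being contractions for \<open>orbit_norm\<close>, so
  smallness on a finite net of K extends to K.\<close>

lemma central_means_small_on_compact:
  assumes K: "compact K" "K \<subseteq> V0" and e: "0 < e"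
  obtains T where "T \<in> central_means" "\<And>v. v \<in> K \<Longrightarrow> norm (T v) < e"
proof -
  obtain r where r: "0 < r" "rho_bound \<le> r"
    using rho_bound_nonneg by (intro that[of "rho_bound + 1"]) auto
  \<comment> \<open>This mesh makes the contribution of the distance to the net at most e / 3, hence
    below e / 2.\<close>
  define d where "d = e / (3 * r)"
  have d: "0 < d" using e r(1) by (simp add: d_def)
  have "rho_bound * d \<le> r * d" using r(2) d by (intro mult_right_mono) auto
  also have "r * d < e / 2" using r(1) e by (simp add: d_def)
  finally have bound_d: "rho_bound * d < e / 2" .
  obtain F where F: "F \<subseteq> K" "finite F" "K \<subseteq> (\<Union>x\<in>F. ball x d)"
    by (rule compactE_image[OF K(1), of K "\<lambda>x. ball x d"]) (use d in auto)
  obtain T where T: "T \<in> central_means" "\<And>v. v \<in> F \<Longrightarrow> orbit_norm (T v) < e / 2"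
    by (rule central_means_uniformly_small[OF F(2) subset_trans[OF F(1) K(2)] half_gt_zero[OF e]]) blast
  show thesis
  proof (rule that[OF T(1)])
    fix v assume "v \<in> K"
    then obtain x where x: "x \<in> F" "dist x v < d" using F(3) by auto
    have "orbit_norm (T (v - x)) \<le> rho_bound * norm (v - x)"
      using central_means_orbit_norm[OF T(1)] orbit_norm_le_norm by (rule order_trans)
    also have "\<dots> \<le> rho_bound * d"
      using x(2) by (intro mult_left_mono rho_bound_nonneg) (simp add: dist_norm norm_minus_commute)
    finally have "norm (T (v - x)) < e / 2" using bound_d norm_le_orbit_norm[of "T (v - x)"] by simp
    moreover have "norm (T x) < e / 2"
      using T(2)[OF x(1)] norm_le_orbit_norm[of "T x"] by simp
    ultimately have "norm (T (v - x) + T x) < e" by norm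
    then show "norm (T v) < e"
      by (simp add: linear_diff[OF central_means_linear[OF T(1)]])
  qed
qed

end


section \<open>Uniform convergence on compact sets\<close>

definition uniform_close ::
  "((nat \<Rightarrow> 'g) \<Rightarrow> 'v::real_normed_vector) \<Rightarrow> (nat \<Rightarrow> 'g) set \<Rightarrow> real \<Rightarrow> ((nat \<Rightarrow> 'g) \<Rightarrow> 'v) \<Rightarrow> bool" where
  "uniform_close f K e g \<longleftrightarrow> (\<forall>x\<in>K. norm (g x - f x) < e)"

lemma cochains_image_compact:
  assumes f: "f \<in> cochains n W" and K: "compactin (group_power n) K"
  shows "compact (f ` K)" and "f ` K \<subseteq> W"
proof -
  have "compactin (top_of_set W) (f ` K)"
    using f K image_compactin by (auto simp: cochains_def)
  then show "compact (f ` K)" "f ` K \<subseteq> W"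
    by (auto simp: compactin_subtopology)
qed

lemma topspace_compact_open: "topspace (compact_open_topology n W) = cochains n W"
proof -
  have "cochains n W \<in> {{f \<in> cochains n W. f ` K \<subseteq> U} | K U.
      compactin (group_power n) K \<and> openin (top_of_set W) U}"
    by (intro CollectI exI[of _ "{}"]) auto
  then show ?thesis
    unfolding compact_open_topology_def topology_generated_by_topspace by blast
qed

text \<open>By induction on the generation of the topology. For a subbasic set, the compact image of
  K keeps a positive distance from the complement of the open set, and that distance serves as the
  tolerance.\<close>

lemma compact_open_contains_uniform:
  assumes "openin (compact_open_topology n W) Q" "f \<in> Q"
  shows "\<exists>K e. compactin (group_power n) K \<and> 0 < e \<and>
           (\<forall>g\<in>cochains n W. uniform_close f K e g \<longrightarrow> g \<in> Q)"
  using assms unfolding compact_open_topology_def openin_topology_generated_by_iff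
proof (induction rule: generate_topology_on.induct)
  case Empty
  then show ?case by simp
next
  case (Int A B)
  then obtain K d L e where
    "compactin (group_power n) K" "0 < d" "\<forall>g\<in>cochains n W. uniform_close f K d g \<longrightarrow> g \<in> A"
    "compactin (group_power n) L" "0 < e" "\<forall>g\<in>cochains n W. uniform_close f L e g \<longrightarrow> g \<in> B"
    by blast
  then show ?case
    by (intro exI[of _ "K \<union> L"] exI[of _ "min d e"]) (auto simp: compactin_Un uniform_close_def)
next
  case (UN \<K>)
  then obtain A where "A \<in> \<K>" "f \<in> A" by blast
  with UN.IH[OF this] show ?case by blast
next
  case (Basis A)
  then obtain K U where A: "A = {f \<in> cochains n W. f ` K \<subseteq> U}"
    and K: "compactin (group_power n) K" and U: "openin (top_of_set W) U"
    by blast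
  obtain U' where U': "open U'" "U = W \<inter> U'" using U by (auto simp: openin_open)
  have f: "f \<in> cochains n W" "f ` K \<subseteq> U'" using Basis.prems A U' by auto
  obtain e where e: "0 < e" "(\<Union>y\<in>f ` K. cball y e) \<subseteq> U'"
    using compact_subset_open_imp_cball_epsilon_subset[OF cochains_image_compact(1)[OF f(1) K] U'(1) f(2)]
    by blast
  show ?case
  proof (intro exI conjI ballI impI)
    fix g assume g: "g \<in> cochains n W" "uniform_close f K e g"
    have "g x \<in> U'" if "x \<in> K" for x
    proof -
      have "g x \<in> cball (f x) e"
        using g(2) that by (auto simp: uniform_close_def dist_norm norm_minus_commute intro: less_imp_le)
      with e(2) that show ?thesis by blast
    qed
    then show "g \<in> A" using g(1) cochains_image_compact(2)[OF g(1) K] A U'(2) by auto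
  qed (use K e in auto)
qed

text \<open>The image of K is covered by finitely many balls of radius e / 4 around values f x.
  \<open>L x\<close> is the part of K mapped into the closed ball at f x, and g is required to map
  it into the ball of radius e / 2. Each \<open>L x\<close> is compact as the intersection of K with
  a closed preimage, so no separation of the group enters.\<close>

lemma compact_open_uniform_neighbourhood:
  assumes f: "f \<in> cochains n W" and K: "compactin (group_power n) K" and e: "0 < e"
  obtains Q where "openin (compact_open_topology n W) Q" "f \<in> Q" "\<And>g. g \<in> Q \<Longrightarrow> uniform_close f K e g"
proof -
  obtain F where F: "finite F" "F \<subseteq> K" "f ` K \<subseteq> (\<Union>x\<in>F. ball (f x) (e / 4))"
  proof -
    have "f ` K \<subseteq> (\<Union>x\<in>K. ball (f x) (e / 4))" using e by auto
    then show thesis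
      by (rule compactE_image[OF cochains_image_compact(1)[OF f K] open_ball]) (rule that)
  qed
  define L where "L x = K \<inter> {y \<in> topspace (group_power n). f y \<in> cball (f x) (e / 4)}" for x
  \<comment> \<open>The factor \<open>cochains n W\<close> keeps Q inside the space when F is
    empty.\<close>
  define Q where "Q = cochains n W \<inter> (\<Inter>x\<in>F. {g \<in> cochains n W. g ` L x \<subseteq> W \<inter> ball (f x) (e / 2)})"
  have cont: "continuous_map (group_power n) euclidean f"
    using f by (auto simp: cochains_def continuous_map_in_subtopology)
  have L: "compactin (group_power n) (L x)" for x
  proof -
    have "closedin (group_power n) {y \<in> topspace (group_power n). f y \<in> cball (f x) (e / 4)}"
      by (rule closedin_continuous_map_preimage[OF cont]) simp
    with K show ?thesis
      unfolding L_def by (subst Int_commute) (rule closed_Int_compactin)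
  qed
  show thesis
  proof
    have "openin (compact_open_topology n W) {g \<in> cochains n W. g ` L x \<subseteq> W \<inter> ball (f x) (e / 2)}" for x
      unfolding compact_open_topology_def
      by (rule topology_generated_by_Basis, intro CollectI exI conjI, rule refl, rule L)
        (simp add: openin_open_Int)
    then show "openin (compact_open_topology n W) Q"
      unfolding Q_def
      by (cases "F = {}") (auto intro!: openin_Int openin_INT2 F(1)
          simp flip: topspace_compact_open)
    show "f \<in> Q"
      using f cochains_image_compact(2)[OF f L] e by (auto simp: Q_def L_def)
    fix g assume g: "g \<in> Q"
    show "uniform_close f K e g"
      unfolding uniform_close_def
    proof
      fix y assume y: "y \<in> K"
      then obtain x where x: "x \<in> F" "dist (f x) (f y) < e / 4" using F(3) by auto
      have "y \<in> L x"
        using x y compactin_subset_topspace[OF K] by (auto simp: L_def)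
      then have "dist (f x) (g y) < e / 2"
        using g x(1) unfolding Q_def by fastforce
      then show "norm (g y - f y) < e"
        using x(2) dist_triangle2[of "g y" "f y" "f x"] dist_triangle_half_l e
        by (simp add: dist_commute dist_norm[symmetric])
    qed
  qed
qed

lemma openin_compact_open_subtopology:
  assumes S: "S \<subseteq> cochains n W"
  shows "openin (subtopology (compact_open_topology n W) S) Q \<longleftrightarrow>
    Q \<subseteq> S \<and> (\<forall>f\<in>Q. \<exists>K e. compactin (group_power n) K \<and> 0 < e \<and>
                 (\<forall>g\<in>S. uniform_close f K e g \<longrightarrow> g \<in> Q))" (is "?L \<longleftrightarrow> ?R")
proof
  assume ?L
  then obtain Q' where Q': "openin (compact_open_topology n W) Q'" "Q = Q' \<inter> S"
    by (auto simp: openin_subtopology)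
  show ?R
  proof (intro conjI ballI)
    fix f assume "f \<in> Q"
    then obtain K e where "compactin (group_power n) K" "0 < e"
      "\<forall>g\<in>cochains n W. uniform_close f K e g \<longrightarrow> g \<in> Q'"
      using compact_open_contains_uniform[OF Q'(1)] Q'(2) by blast
    then show "\<exists>K e. compactin (group_power n) K \<and> 0 < e \<and> (\<forall>g\<in>S. uniform_close f K e g \<longrightarrow> g \<in> Q)"
      using S Q'(2) by blast
  qed (use Q'(2) in auto)
next
  assume R: ?R
  show ?L
  proof (subst openin_subopen, intro ballI)
    fix f assume f: "f \<in> Q"
    with R obtain K e where K: "compactin (group_power n) K" "0 < e"
      "\<forall>g\<in>S. uniform_close f K e g \<longrightarrow> g \<in> Q" by blast
    obtain N where N: "openin (compact_open_topology n W) N" "f \<in> N"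
      "\<And>g. g \<in> N \<Longrightarrow> uniform_close f K e g"
      using compact_open_uniform_neighbourhood[OF _ K(1,2)] f R S by blast
    show "\<exists>T. openin (subtopology (compact_open_topology n W) S) T \<and> f \<in> T \<and> T \<subseteq> Q"
      using N K(3) f R by (intro exI[of _ "N \<inter> S"]) (auto simp: openin_subtopology)
  qed
qed

text \<open>Uniform convergence on compact sets does not refer to the space \<open>W\<close> of values, so the topologies
  of cochains with values in different \<open>W\<close> are subspaces of a single one.\<close>

definition uniform_topology ::
  "nat \<Rightarrow> ((nat \<Rightarrow> 'g::topological_space) \<Rightarrow> 'v::real_normed_vector) set \<Rightarrow> ((nat \<Rightarrow> 'g) \<Rightarrow> 'v) topology" where
  "uniform_topology n S = subtopology (compact_open_topology n UNIV) S"

lemma cochains_mono: "W \<subseteq> W' \<Longrightarrow> cochains n W \<subseteq> cochains n W'"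
  by (auto simp: cochains_def continuous_map_in_subtopology)

lemma openin_uniform_topology:
  assumes "S \<subseteq> cochains n UNIV"
  shows "openin (uniform_topology n S) Q \<longleftrightarrow>
    Q \<subseteq> S \<and> (\<forall>f\<in>Q. \<exists>K e. compactin (group_power n) K \<and> 0 < e \<and>
                 (\<forall>g\<in>S. uniform_close f K e g \<longrightarrow> g \<in> Q))"
  unfolding uniform_topology_def by (rule openin_compact_open_subtopology[OF assms])

lemma subtopology_compact_open:
  assumes "S \<subseteq> cochains n W"
  shows "subtopology (compact_open_topology n W) S = uniform_topology n S"
proof -
  have "S \<subseteq> cochains n UNIV" using assms cochains_mono[of W UNIV] by blast
  then show ?thesis
    by (simp add: topology_eq openin_compact_open_subtopology[OF assms] openin_uniform_topology)
qed

lemma topspace_uniform_topology: "S \<subseteq> cochains n UNIV \<Longrightarrow> topspace (uniform_topology n S) = S"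
  by (auto simp: uniform_topology_def topspace_compact_open)

lemma subtopology_uniform_topology: "T \<subseteq> S \<Longrightarrow> subtopology (uniform_topology n S) T = uniform_topology n T"
  by (simp add: uniform_topology_def subtopology_subtopology inf.absorb2)

lemma uniform_neighbourhood:
  assumes S: "S \<subseteq> cochains n UNIV" and f: "f \<in> S" and "compactin (group_power n) K" "0 < e"
  obtains Q where "openin (uniform_topology n S) Q" "f \<in> Q" "\<And>g. g \<in> Q \<Longrightarrow> uniform_close f K e g"
proof -
  obtain N where N: "openin (compact_open_topology n UNIV) N" "f \<in> N"
      "\<And>g. g \<in> N \<Longrightarrow> uniform_close f K e g"
    using compact_open_uniform_neighbourhood[of f n UNIV K e] assms by blast
  then show thesis
    using f by (intro that[of "N \<inter> S"]) (auto simp: uniform_topology_def openin_subtopology)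
qed

lemma in_closure_uniform_topology:
  fixes S :: "((nat \<Rightarrow> 'g::topological_space) \<Rightarrow> 'v::real_normed_vector) set"
  assumes S: "S \<subseteq> cochains n UNIV" and B: "B \<subseteq> S"
  shows "f \<in> uniform_topology n S closure_of B \<longleftrightarrow>
    f \<in> S \<and> (\<forall>K e. compactin (group_power n) K \<and> 0 < e \<longrightarrow> (\<exists>g\<in>B. uniform_close f K e g))"
    (is "?L \<longleftrightarrow> ?R")
proof
  assume ?L
  show ?R
  proof (intro conjI allI impI)
    show f: "f \<in> S" using \<open>?L\<close> S by (simp add: in_closure_of topspace_uniform_topology)
    fix K :: "(nat \<Rightarrow> 'g) set" and e :: real assume "compactin (group_power n) K \<and> 0 < e"
    then obtain Q where "openin (uniform_topology n S) Q" "f \<in> Q" "\<And>g. g \<in> Q \<Longrightarrow> uniform_close f K e g"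
      using uniform_neighbourhood[OF S f] by blast
    with \<open>?L\<close> show "\<exists>g\<in>B. uniform_close f K e g"
      unfolding in_closure_of by blast
  qed
next
  assume R: ?R
  show ?L
    unfolding in_closure_of
  proof (intro conjI allI impI)
    show "f \<in> topspace (uniform_topology n S)" using R S by (simp add: topspace_uniform_topology)
    fix Q assume "f \<in> Q \<and> openin (uniform_topology n S) Q"
    then obtain K e where "compactin (group_power n) K" "0 < e" "\<forall>g\<in>S. uniform_close f K e g \<longrightarrow> g \<in> Q"
      using openin_uniform_topology[OF S] by blast
    with R B show "\<exists>y. y \<in> B \<and> y \<in> Q" by blast
  qed
qed

lemma continuous_map_uniform_topology:
  assumes S: "S \<subseteq> cochains n UNIV" and T: "T \<subseteq> cochains n UNIV"
    and F: "\<And>f. f \<in> S \<Longrightarrow> F f \<in> T" and C: "0 < C"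
    and bound: "\<And>f g x. f \<in> S \<Longrightarrow> g \<in> S \<Longrightarrow> norm (F g x - F f x) \<le> C * norm (g x - f x)"
  shows "continuous_map (uniform_topology n S) (uniform_topology n T) F"
  unfolding continuous_map_def topspace_uniform_topology[OF S] topspace_uniform_topology[OF T]
proof (intro conjI allI impI)
  fix Q assume Q: "openin (uniform_topology n T) Q"
  show "openin (uniform_topology n S) {f \<in> S. F f \<in> Q}"
    unfolding openin_uniform_topology[OF S]
  proof (intro conjI ballI)
    fix f assume f: "f \<in> {f \<in> S. F f \<in> Q}"
    then obtain K e where K: "compactin (group_power n) K" "0 < e"
      "\<forall>g\<in>T. uniform_close (F f) K e g \<longrightarrow> g \<in> Q"
      using Q openin_uniform_topology[OF T] by blast
    show "\<exists>K e. compactin (group_power n) K \<and> 0 < e \<and>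
        (\<forall>g\<in>S. uniform_close f K e g \<longrightarrow> g \<in> {f \<in> S. F f \<in> Q})"
    proof (intro exI conjI ballI impI)
      show "compactin (group_power n) K" "0 < e / C" using K C by auto
      fix g assume g: "g \<in> S" "uniform_close f K (e / C) g"
      have "uniform_close (F f) K e (F g)"
        unfolding uniform_close_def
      proof
        fix x assume "x \<in> K"
        have "norm (F g x - F f x) \<le> C * norm (g x - f x)" using bound f g(1) by auto
        also have "\<dots> < e" using g(2) \<open>x \<in> K\<close> C by (auto simp: uniform_close_def field_simps)
        finally show "norm (F g x - F f x) < e" .
      qed
      with K(3) F g(1) show "g \<in> {f \<in> S. F f \<in> Q}" by auto
    qed
  qed auto
qed (use F in auto)

lemma continuous_map_uniform_add:
  assumes S: "S \<subseteq> cochains n UNIV" and A: "A \<subseteq> S" and B: "B \<subseteq> S"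
    and add: "\<And>f g. f \<in> A \<Longrightarrow> g \<in> B \<Longrightarrow> f + g \<in> S"
  shows "continuous_map (prod_topology (uniform_topology n A) (uniform_topology n B))
           (uniform_topology n S) (\<lambda>(f, g). f + g)"
proof -
  have A': "A \<subseteq> cochains n UNIV" and B': "B \<subseteq> cochains n UNIV" using A B S by auto
  show ?thesis
    unfolding continuous_map_def topspace_uniform_topology[OF S] topspace_prod_topology
      topspace_uniform_topology[OF A'] topspace_uniform_topology[OF B']
  proof (intro conjI allI impI)
    fix Q assume Q: "openin (uniform_topology n S) Q"
    show "openin (prod_topology (uniform_topology n A) (uniform_topology n B))
        {p \<in> A \<times> B. (case p of (f, g) \<Rightarrow> f + g) \<in> Q}"
      unfolding openin_prod_topology_alt
    proof (intro allI impI)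
      fix f g assume fg: "(f, g) \<in> {p \<in> A \<times> B. (case p of (f, g) \<Rightarrow> f + g) \<in> Q}"
      then have "f + g \<in> Q" by simp
      then obtain K e where K: "compactin (group_power n) K" "0 < e"
        "\<forall>h\<in>S. uniform_close (f + g) K e h \<longrightarrow> h \<in> Q"
        using Q openin_uniform_topology[OF S] by blast
      obtain M where M: "openin (uniform_topology n A) M" "f \<in> M"
        "\<And>h. h \<in> M \<Longrightarrow> uniform_close f K (e / 2) h"
        using uniform_neighbourhood[OF A' _ K(1), of f "e / 2"] fg K(2) by auto
      obtain N where N: "openin (uniform_topology n B) N" "g \<in> N"
        "\<And>h. h \<in> N \<Longrightarrow> uniform_close g K (e / 2) h"
        using uniform_neighbourhood[OF B' _ K(1), of g "e / 2"] fg K(2) by auto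
      have MA: "M \<subseteq> A" and NB: "N \<subseteq> B"
        using openin_subset[OF M(1)] openin_subset[OF N(1)]
        by (auto simp: topspace_uniform_topology[OF A'] topspace_uniform_topology[OF B'])
      have "h + k \<in> Q" if "h \<in> M" "k \<in> N" for h k
      proof -
        have "uniform_close (f + g) K e (h + k)"
          unfolding uniform_close_def
        proof
          fix x assume "x \<in> K"
          then have "norm (h x - f x) < e / 2" "norm (k x - g x) < e / 2"
            using M(3)[OF that(1)] N(3)[OF that(2)] by (auto simp: uniform_close_def)
          then show "norm ((h + k) x - (f + g) x) < e"
            unfolding plus_fun_apply by norm
        qed
        then show ?thesis using K(3) add that MA NB by blast
      qed
      then show "\<exists>U V. openin (uniform_topology n A) U \<and> openin (uniform_topology n B) V \<and>
          f \<in> U \<and> g \<in> V \<and> U \<times> V \<subseteq> {p \<in> A \<times> B. (case p of (f, g) \<Rightarrow> f + g) \<in> Q}"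
        using M N MA NB by (intro exI[of _ M] exI[of _ N]) auto
    qed
  qed (use add in auto)
qed

text \<open>F is a continuous retraction of X onto Y that moves points only within N and maps N into
  N'. It induces the isomorphism by taking images of cosets. The inverse is induced by the inclusion
  and sends a coset B of N' to B + N; both maps are continuous by the universal property of the
  quotient.\<close>

lemma tvs_quotient_isomorphic:
  fixes s :: "'k \<Rightarrow> 'a::ab_group_add \<Rightarrow> 'a"
  assumes F: "continuous_map X Y F" and inc: "continuous_map Y X (\<lambda>y. y)"
    and F_add: "\<And>x y. F (x + y) = F x + F y" and F_scale: "\<And>c x. F (s c x) = s c (F x)"
    and N: "0 \<in> N" "\<And>x y. x \<in> N \<Longrightarrow> y \<in> N \<Longrightarrow> x + y \<in> N" "\<And>x. x \<in> N \<Longrightarrow> - x \<in> N"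
    and N': "0 \<in> N'" "N' \<subseteq> N" "N' \<subseteq> topspace Y" "F ` N \<subseteq> N'"
    and F_id: "\<And>y. y \<in> topspace Y \<Longrightarrow> F y = y"
    and diff: "\<And>x. x \<in> topspace X \<Longrightarrow> x - F x \<in> N"
  shows "tvs_isomorphic (tvs_quotient s X N) (tvs_quotient s Y N')"
proof -
  let ?q = "\<lambda>x. x +o N" and ?q' = "\<lambda>y. y +o N'"
  have FN: "F ` N = N'"
    using N' F_id by (auto simp: image_iff) (metis subsetD)
  have F_plus: "F ` (A + B) = F ` A + F ` B" for A B
  proof (intro equalityI subsetI)
    show "y \<in> F ` A + F ` B" if y: "y \<in> F ` (A + B)" for y
    proof -
      obtain a b where "a \<in> A" "b \<in> B" "y = F a + F b"
        using y by (auto elim!: set_plus_elim simp: F_add)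
      then show ?thesis by (simp add: set_plus_intro)
    qed
    show "y \<in> F ` (A + B)" if y: "y \<in> F ` A + F ` B" for y
    proof -
      obtain a b where "a \<in> A" "b \<in> B" "y = F (a + b)"
        using y by (auto elim!: set_plus_elim simp: F_add)
      then show ?thesis by (auto intro: set_plus_intro)
    qed
  qed
  have F_coset: "F ` (x +o N) = F x +o N'" for x
    by (auto simp: elt_set_plus_def F_add image_iff FN[symmetric]) (metis F_add)
  have NN: "N' + N = N"
    using N N' by (auto simp: set_plus_def) (metis add_0)
  have coset_eq: "x +o N = y +o N" if "x - y \<in> N" for x y
  proof -
    have "x + a = y + ((x - y) + a)" "y + a = x + (- (x - y) + a)" for a by auto
    then show ?thesis
      using N that unfolding elt_set_plus_def by (auto; metis)
  qed
  have add_N: "(y +o N') + N = y +o N" for y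
    using NN by (simp add: set_plus_rearrange2 set_plus_rearrange3 set_plus_rearrange4)
  have "homeomorphic_maps (quotient_topology X ?q) (quotient_topology Y ?q') (image F) (\<lambda>B. B + N)"
    unfolding homeomorphic_maps_def
  proof (intro conjI ballI)
    have "continuous_map X (quotient_topology Y ?q') (image F \<circ> ?q)"
      using continuous_map_compose[OF F quotient_imp_continuous_map[OF quotient_map_quotient_topology]]
      by (simp add: o_def F_coset)
    then show "continuous_map (quotient_topology X ?q) (quotient_topology Y ?q') (image F)"
      by (rule continuous_compose_quotient_map[OF quotient_map_quotient_topology])
    have "continuous_map Y (quotient_topology X ?q) ((\<lambda>B. B + N) \<circ> ?q')"
      using continuous_map_compose[OF inc quotient_imp_continuous_map[OF quotient_map_quotient_topology[of X ?q]]]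
      by (simp add: o_def add_N)
    then show "continuous_map (quotient_topology Y ?q') (quotient_topology X ?q) (\<lambda>B. B + N)"
      by (rule continuous_compose_quotient_map[OF quotient_map_quotient_topology])
  next
    fix A assume "A \<in> topspace (quotient_topology X ?q)"
    then obtain x where x: "x \<in> topspace X" "A = x +o N" by (auto simp: topspace_quotient_topology)
    have "F ` A + N = F x +o N" by (simp only: x(2) F_coset add_N)
    also have "\<dots> = A" using coset_eq[OF diff[OF x(1)]] x(2) by simp
    finally show "F ` A + N = A" .
  next
    fix B assume "B \<in> topspace (quotient_topology Y ?q')"
    then obtain y where "y \<in> topspace Y" "B = y +o N'" by (auto simp: topspace_quotient_topology)
    then show "F ` (B + N) = B" by (simp add: add_N F_coset F_id)
  qed
  then have "homeomorphic_map (quotient_topology X ?q) (quotient_topology Y ?q') (image F)"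
    by (rule homeomorphic_maps_imp_map)
  moreover have "F ` (s c ` A + N) = s c ` F ` A + N'" for c A
    by (simp add: F_plus FN image_image F_scale)
  ultimately show ?thesis
    unfolding tvs_isomorphic_def tvs_quotient_def
    by (intro exI[of _ "image F"]) (simp add: F_plus)
qed


section \<open>Cochains and the prism homotopy\<close>

lemma topspace_group_power: "topspace (group_power n) = {..<n} \<rightarrow>\<^sub>E UNIV"
  by (simp add: group_power_def)

lemma continuous_map_group_power_component:
  "j < n \<Longrightarrow> continuous_map (group_power n) euclidean (\<lambda>x. x j)"
  unfolding group_power_def by (rule continuous_map_product_projection) simp

lemma continuous_map_into_group_power:
  assumes "\<And>j. j < n \<Longrightarrow> continuous_map X euclidean (\<lambda>x. f x j)"
  shows "continuous_map X (group_power n) (\<lambda>x. \<lambda>j\<in>{..<n}. f x j)"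
  unfolding group_power_def using assms by (subst continuous_map_componentwise) auto

lemma omit_in_topspace: "omit n i x \<in> topspace (group_power n)"
  by (simp add: topspace_group_power omit_def)

lemma continuous_map_omit:
  assumes "i \<le> n"
  shows "continuous_map (group_power (Suc n)) (group_power n) (omit n i)"
  unfolding omit_def
  by (rule continuous_map_into_group_power, rule continuous_map_group_power_component) auto

text \<open>The simplicial identity for face maps, responsible for the vanishing of the square of
  the coboundary.\<close>

lemma omit_omit:
  assumes "i \<le> j"
  shows "omit n i (omit (Suc n) (Suc j) x) = omit n j (omit (Suc n) i x)"
  unfolding omit_def using assms by (intro restrict_ext) auto

lemma cochains_continuous: "f \<in> cochains n W \<Longrightarrow> continuous_map (group_power n) euclidean f"
  by (auto simp: cochains_def continuous_map_in_subtopology)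

lemma cochains_value: "f \<in> cochains n W \<Longrightarrow> x \<in> topspace (group_power n) \<Longrightarrow> f x \<in> W"
  by (auto simp: cochains_def continuous_map_in_subtopology)

lemma cochains_outside: "f \<in> cochains n W \<Longrightarrow> x \<notin> topspace (group_power n) \<Longrightarrow> f x = 0"
  by (simp add: cochains_def)

lemma cochainsI:
  assumes "continuous_map (group_power n) euclidean f"
    "\<And>x. x \<in> topspace (group_power n) \<Longrightarrow> f x \<in> W"
    "\<And>x. x \<notin> topspace (group_power n) \<Longrightarrow> f x = 0"
  shows "f \<in> cochains n W"
  using assms by (auto simp: cochains_def continuous_map_in_subtopology)

lemma coboundary_map_apply:
  "x \<in> topspace (group_power (Suc n)) \<Longrightarrow>
    coboundary_map n f x = (\<Sum>i\<le>n. (- 1) ^ i *\<^sub>R f (omit n i x))"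
  by (simp add: coboundary_map_def)

lemma coboundary_map_outside: "x \<notin> topspace (group_power (Suc n)) \<Longrightarrow> coboundary_map n f x = 0"
  by (simp add: coboundary_map_def)

lemma coboundary_map_linear_compose:
  assumes "linear T"
  shows "coboundary_map n (\<lambda>x. T (f x)) = (\<lambda>x. T (coboundary_map n f x))"
  by (rule ext) (simp add: coboundary_map_def linear_sum[OF assms] linear_cmul[OF assms] linear_0[OF assms])

lemma coboundary_map_add: "coboundary_map n (f + g) = coboundary_map n f + coboundary_map n g"
  by (rule ext) (simp add: coboundary_map_def scaleR_add_right sum.distrib)

lemma coboundary_map_zero: "coboundary_map n 0 = 0"
  by (rule ext) (simp add: coboundary_map_def)

lemma coboundary_coboundary: "coboundary_map (Suc n) (coboundary_map n f) = 0"
proof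
  fix x :: "nat \<Rightarrow> 'a"
  show "coboundary_map (Suc n) (coboundary_map n f) x = 0 x"
  proof (cases "x \<in> topspace (group_power (Suc (Suc n)))")
    case True
    define t where "t i j = f (omit n i (omit (Suc n) j x))" for i j
    have t: "t i (Suc j) = t j i" if "i \<le> j" for i j
      using omit_omit[OF that, of n x] by (simp add: t_def)
    have "coboundary_map (Suc n) (coboundary_map n f) x =
        (\<Sum>j\<le>Suc n. (- 1) ^ j *\<^sub>R (\<Sum>i\<le>n. (- 1) ^ i *\<^sub>R t i j))"
      using True by (simp add: coboundary_map_apply omit_in_topspace t_def del: sum.atMost_Suc)
    also have "\<dots> = (\<Sum>(j, i)\<in>{..Suc n} \<times> {..n}. (- 1) ^ (i + j) *\<^sub>R t i j)"
      by (simp add: scaleR_sum_right sum.cartesian_product power_add mult.commute del: sum.atMost_Suc)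
    also have "{..Suc n} \<times> {..n} = {(j, i). i < j \<and> j \<le> Suc n} \<union> {(j, i). j \<le> i \<and> i \<le> n}"
      by auto
    also have "(\<Sum>(j, i)\<in>\<dots>. (- 1) ^ (i + j) *\<^sub>R t i j) =
        (\<Sum>(j, i)\<in>{(j, i). i < j \<and> j \<le> Suc n}. (- 1) ^ (i + j) *\<^sub>R t i j) +
        (\<Sum>(j, i)\<in>{(j, i). j \<le> i \<and> i \<le> n}. (- 1) ^ (i + j) *\<^sub>R t i j)"
    proof (rule sum.union_disjoint)
      show "finite {(j, i). i < j \<and> j \<le> Suc n}"
        by (rule finite_subset[of _ "{..Suc n} \<times> {..n}"]) auto
      show "finite {(j, i). j \<le> i \<and> i \<le> n}"
        by (rule finite_subset[of _ "{..Suc n} \<times> {..n}"]) auto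
    qed auto
    \<comment> \<open>The simplicial identity pairs (j, i) in one half of the index set with (i, j -
      1) in the other; lowering one index by 1 reverses the sign, so the halves cancel.\<close>
    also have "(\<Sum>(j, i)\<in>{(j, i). i < j \<and> j \<le> Suc n}. (- 1) ^ (i + j) *\<^sub>R t i j) =
        (\<Sum>(j, i)\<in>{(j, i). j \<le> i \<and> i \<le> n}. - ((- 1) ^ (i + j) *\<^sub>R t i j))"
    proof (rule sum.reindex_bij_witness[where i = "\<lambda>(j, i). (Suc i, j)" and j = "\<lambda>(j, i). (i, j - 1)"])
      fix a assume "a \<in> {(j, i). i < j \<and> j \<le> Suc n}"
      then obtain j i where a: "a = (Suc j, i)" "i \<le> j" "j \<le> n"
        by (cases a; cases "fst a") auto
      then show "(case case a of (j, i) \<Rightarrow> (i, j - 1) of (j, i) \<Rightarrow> - ((- 1) ^ (i + j) *\<^sub>R t i j)) =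
          (case a of (j, i) \<Rightarrow> (- 1) ^ (i + j) *\<^sub>R t i j)"
        by (simp add: t add.commute)
    qed auto
    also have "\<dots> + (\<Sum>(j, i)\<in>{(j, i). j \<le> i \<and> i \<le> n}. (- 1) ^ (i + j) *\<^sub>R t i j) = 0"
      by (simp add: case_prod_unfold sum_negf)
    finally show ?thesis by simp
  qed (simp add: coboundary_map_outside)
qed

text \<open>The simplex \<open>(x\<^sub>0, \<dots>, x\<^sub>i, z x\<^sub>i, \<dots>, z x\<^bsub>n-1\<^esub>)\<close> of the prism between
  \<open>x\<close> and its translate by \<open>z\<close>.\<close>

definition prism :: "nat \<Rightarrow> 'g::plus \<Rightarrow> nat \<Rightarrow> (nat \<Rightarrow> 'g) \<Rightarrow> (nat \<Rightarrow> 'g)" where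
  "prism n z i x = (\<lambda>j\<in>{..<Suc n}. if j \<le> i then x j else z + x (j - 1))"

text \<open>For n = 0 the sum is empty. This is consistent with
  \<open>coboundary_prism_homotopy\<close>, because a cocycle on G itself is constant.\<close>

definition prism_homotopy ::
  "nat \<Rightarrow> 'g::topological_group_add \<Rightarrow> ((nat \<Rightarrow> 'g) \<Rightarrow> 'v::real_normed_vector) \<Rightarrow> (nat \<Rightarrow> 'g) \<Rightarrow> 'v" where
  "prism_homotopy n z f = (\<lambda>x. if x \<in> topspace (group_power n)
      then \<Sum>i<n. (- 1) ^ i *\<^sub>R f (prism n z i x) else 0)"

lemma prism_in_topspace: "prism n z i x \<in> topspace (group_power (Suc n))"
  by (simp add: topspace_group_power prism_def)

lemma continuous_map_prism:
  fixes z :: "'g::topological_group_add"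
  assumes "i < n"
  shows "continuous_map (group_power n) (group_power (Suc n)) (prism n z i)"
  unfolding prism_def
proof (rule continuous_map_into_group_power)
  fix j assume j: "j < Suc n"
  show "continuous_map (group_power n) euclidean (\<lambda>x. if j \<le> i then x j else z + x (j - 1))"
  proof (cases "j \<le> i")
    case True
    then show ?thesis using assms by (simp add: continuous_map_group_power_component)
  next
    case False
    have "continuous_map euclidean euclidean (\<lambda>y. z + y)"
      by (simp add: continuous_on_add continuous_on_const continuous_on_id)
    from continuous_map_compose[OF continuous_map_group_power_component[of "j - 1" n] this]
    show ?thesis using False j by (simp add: o_def)
  qed
qed

text \<open>Faces of a prism simplex away from its diagonal are prism simplices over faces of x. The
  two faces at the diagonal interpolate between x and its translate, and neighbouring simplices
  share one of them.\<close>

lemma omit_prism_below: "j \<le> i \<Longrightarrow> i < n \<Longrightarrow>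
    omit (Suc n) j (prism (Suc n) z (Suc i) x) = prism n z i (omit n j x)"
  unfolding omit_def prism_def by (intro ext) (auto simp: restrict_def)

lemma omit_prism_above: "i < j \<Longrightarrow> j \<le> n \<Longrightarrow>
    omit (Suc n) (Suc j) (prism (Suc n) z i x) = prism n z i (omit n j x)"
  unfolding omit_def prism_def by (intro ext) (auto simp: restrict_def)

lemma omit_prism_middle: "i \<le> n \<Longrightarrow>
    omit (Suc n) (Suc i) (prism (Suc n) z i x) = (\<lambda>j\<in>{..<Suc n}. if j < Suc i then x j else z + x j)"
  and omit_prism_diagonal: "i \<le> n \<Longrightarrow>
    omit (Suc n) i (prism (Suc n) z i x) = (\<lambda>j\<in>{..<Suc n}. if j < i then x j else z + x j)"
  unfolding omit_def prism_def by (intro ext; auto simp: restrict_def)+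

text \<open>Apply the cocycle identity of f to each simplex of the prism over x and add up with
  signs. The faces shared by neighbours telescope to the two ends of the prism, and the remaining
  faces form the coboundary of the homotopy.\<close>

lemma coboundary_prism_homotopy:
  fixes f :: "(nat \<Rightarrow> 'g::topological_group_add) \<Rightarrow> 'v::real_normed_vector"
  assumes f: "coboundary_map (Suc n) f = 0" and x: "x \<in> topspace (group_power (Suc n))"
  shows "coboundary_map n (prism_homotopy n z f) x = f (\<lambda>j\<in>{..<Suc n}. z + x j) - f x"
proof -
  define F where "F i = f (\<lambda>j\<in>{..<Suc n}. if j < i then x j else z + x j)" for i
  define h where "h i j = f (prism n z i (omit n j x))" for i j
  have cocycle: "(\<Sum>j\<le>Suc n. (- 1) ^ j *\<^sub>R f (omit (Suc n) j (prism (Suc n) z i x))) = 0" for i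
    using fun_cong[OF f, of "prism (Suc n) z i x"]
    by (simp add: coboundary_map_apply prism_in_topspace del: sum.atMost_Suc)
  \<comment> \<open>The faces of simplex i are grouped into j < i, the two diagonal faces i and
    \<open>Suc i\<close>, and those beyond. The last group carries the opposite sign because its
    index is shifted by one.\<close>
  have split: "(\<Sum>j<i. (- 1) ^ (i + j) *\<^sub>R h (i - 1) j) + (F i - F (Suc i)) -
      (\<Sum>j\<in>{i<..n}. (- 1) ^ (i + j) *\<^sub>R h i j) = 0" if i: "i \<le> n" for i
  proof -
    let ?g = "\<lambda>j. (- 1) ^ (i + j) *\<^sub>R f (omit (Suc n) j (prism (Suc n) z i x))"
    have "(- 1) ^ i *\<^sub>R (\<Sum>j\<le>Suc n. (- 1) ^ j *\<^sub>R f (omit (Suc n) j (prism (Suc n) z i x))) = 0"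
      by (simp only: cocycle scaleR_zero_right)
    then have "0 = (\<Sum>j\<le>Suc n. ?g j)"
      by (simp only: scaleR_sum_right scaleR_scaleR power_add)
    also have "{..Suc n} = {..<i} \<union> ({i, Suc i} \<union> Suc ` {i<..n})"
      using i by (auto simp: image_iff) (metis Suc_le_D Suc_le_mono greaterThanAtMost_iff
          le_neq_implies_less not_less_eq_eq)
    also have "(\<Sum>j\<in>\<dots>. ?g j) = (\<Sum>j<i. ?g j) + ((?g i + ?g (Suc i)) + (\<Sum>j\<in>Suc ` {i<..n}. ?g j))"
    proof -
      have "(\<Sum>j\<in>{i, Suc i} \<union> Suc ` {i<..n}. ?g j) = (\<Sum>j\<in>{i, Suc i}. ?g j) + (\<Sum>j\<in>Suc ` {i<..n}. ?g j)"
        by (rule sum.union_disjoint) auto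
      moreover have "(\<Sum>j\<in>{i, Suc i}. ?g j) = ?g i + ?g (Suc i)" by simp
      ultimately show ?thesis by (subst sum.union_disjoint) auto
    qed
    also have "(\<Sum>j\<in>Suc ` {i<..n}. ?g j) = (\<Sum>j\<in>{i<..n}. - ((- 1) ^ (i + j) *\<^sub>R h i j))"
      by (subst sum.reindex) (auto intro!: sum.cong simp: h_def omit_prism_above)
    also have "(\<Sum>j<i. ?g j) = (\<Sum>j<i. (- 1) ^ (i + j) *\<^sub>R h (i - 1) j)"
    proof (rule sum.cong[OF refl])
      fix j assume "j \<in> {..<i}"
      then show "?g j = (- 1) ^ (i + j) *\<^sub>R h (i - 1) j"
        using omit_prism_below[of j "i - 1" n z x] i by (simp add: h_def)
    qed
    also have "?g i + ?g (Suc i) = F i - F (Suc i)"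
      using i by (simp add: F_def omit_prism_middle omit_prism_diagonal flip: power_add)
    finally show ?thesis by (simp add: sum_negf algebra_simps)
  qed
  have "(\<Sum>i\<le>n. \<Sum>j<i. (- 1) ^ (i + j) *\<^sub>R h (i - 1) j) + (F 0 - F (Suc n)) -
      (\<Sum>i\<le>n. \<Sum>j\<in>{i<..n}. (- 1) ^ (i + j) *\<^sub>R h i j) = 0"
  proof -
    have "(\<Sum>i\<le>n. (\<Sum>j<i. (- 1) ^ (i + j) *\<^sub>R h (i - 1) j) + (F i - F (Suc i)) -
      (\<Sum>j\<in>{i<..n}. (- 1) ^ (i + j) *\<^sub>R h i j)) = 0"
      by (rule sum.neutral) (use split in auto)
    moreover have "(\<Sum>i\<le>n. F i - F (Suc i)) = F 0 - F (Suc n)"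
      by (rule sum_telescope)
    ultimately show ?thesis by (simp only: sum.distrib sum_subtractf)
  qed
  \<comment> \<open>The inner sum for i = 0 is empty, and the shift of i by one produces the minus
    sign.\<close>
  moreover have "(\<Sum>i\<le>n. \<Sum>j<i. (- 1) ^ (i + j) *\<^sub>R h (i - 1) j) =
      - (\<Sum>i<n. \<Sum>j\<le>i. (- 1) ^ (i + j) *\<^sub>R h i j)"
  proof -
    have "(\<Sum>i\<le>n. \<Sum>j<i. (- 1) ^ (i + j) *\<^sub>R h (i - 1) j) =
        (\<Sum>i<n. \<Sum>j<Suc i. (- 1) ^ (Suc i + j) *\<^sub>R h (Suc i - 1) j)"
      by (simp only: sum.atMost_shift lessThan_0 sum.empty add_0_left)
    then show ?thesis
      by (simp add: lessThan_Suc_atMost sum_negf del: sum.lessThan_Suc sum.atMost_Suc)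
  qed
  \<comment> \<open>The inner sum for i = n is empty. With i < n in both sums, the two triangles
    fill the rectangle over which the coboundary of the homotopy is summed.\<close>
  moreover have "(\<Sum>i\<le>n. \<Sum>j\<in>{i<..n}. (- 1) ^ (i + j) *\<^sub>R h i j) =
      (\<Sum>i<n. \<Sum>j\<in>{i<..n}. (- 1) ^ (i + j) *\<^sub>R h i j)"
    by (simp flip: lessThan_Suc_atMost)
  moreover have "(\<Sum>i<n. \<Sum>j\<le>i. (- 1) ^ (i + j) *\<^sub>R h i j) +
      (\<Sum>i<n. \<Sum>j\<in>{i<..n}. (- 1) ^ (i + j) *\<^sub>R h i j) = coboundary_map n (prism_homotopy n z f) x"
  proof -
    have "(\<Sum>j\<le>i. (- 1) ^ (i + j) *\<^sub>R h i j) + (\<Sum>j\<in>{i<..n}. (- 1) ^ (i + j) *\<^sub>R h i j) =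
        (\<Sum>j\<le>n. (- 1) ^ (i + j) *\<^sub>R h i j)" if "i < n" for i
    proof -
      have eq: "{..n} = {..i} \<union> {i<..n}" using that by auto
      show ?thesis unfolding eq by (rule sum.union_disjoint[symmetric]) auto
    qed
    then have "(\<Sum>i<n. \<Sum>j\<le>i. (- 1) ^ (i + j) *\<^sub>R h i j) +
        (\<Sum>i<n. \<Sum>j\<in>{i<..n}. (- 1) ^ (i + j) *\<^sub>R h i j) =
        (\<Sum>i<n. \<Sum>j\<le>n. (- 1) ^ (i + j) *\<^sub>R h i j)"
      by (simp flip: sum.distrib)
    also have "\<dots> = (\<Sum>j\<le>n. \<Sum>i<n. (- 1) ^ (i + j) *\<^sub>R h i j)"
      by (rule sum.swap)
    also have "\<dots> = coboundary_map n (prism_homotopy n z f) x"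
      using x by (simp add: coboundary_map_apply prism_homotopy_def omit_in_topspace h_def
          scaleR_sum_right power_add mult.commute)
    finally show ?thesis .
  qed
  moreover have "F 0 = f (\<lambda>j\<in>{..<Suc n}. z + x j)"
    by (simp add: F_def)
  moreover have "F (Suc n) = f x"
  proof -
    have "(\<lambda>j\<in>{..<Suc n}. if j < Suc n then x j else z + x j) = x"
      using x by (auto simp: topspace_group_power PiE_def extensional_def restrict_def fun_eq_iff)
    then show ?thesis by (simp add: F_def)
  qed
  ultimately show ?thesis by (simp add: algebra_simps)
qed

lemma continuous_map_signed_sum:
  fixes f :: "nat \<Rightarrow> 'a \<Rightarrow> 'v::real_normed_vector"
  assumes "\<And>i. i \<in> I \<Longrightarrow> continuous_map X euclidean (f i)"
  shows "continuous_map X euclidean (\<lambda>x. \<Sum>i\<in>I. (- 1) ^ i *\<^sub>R f i x)"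
proof (cases "finite I")
  case True
  have "continuous_map X euclidean (\<lambda>x. c *\<^sub>R f i x)" if "i \<in> I" for i and c :: real
  proof -
    have "continuous_map euclidean euclidean (\<lambda>v::'v. c *\<^sub>R v)"
      by (simp add: continuous_on_scaleR continuous_on_const continuous_on_id)
    from continuous_map_compose[OF assms[OF that] this] show ?thesis by (simp add: o_def)
  qed
  with True show ?thesis by (intro continuous_map_sum)
qed simp

lemma signed_sum_closed:
  assumes "real_vector.subspace W" "\<And>i. i \<in> I \<Longrightarrow> v i \<in> W"
  shows "(\<Sum>i\<in>I. (- 1) ^ i *\<^sub>R v i) \<in> W"
  using assms by (intro real_vector.subspace_sum real_vector.subspace_scale) auto

lemma coboundary_map_cochain:
  assumes W: "real_vector.subspace W" and f: "f \<in> cochains n W"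
  shows "coboundary_map n f \<in> cochains (Suc n) W"
proof (rule cochainsI)
  have "continuous_map (group_power (Suc n)) euclidean (\<lambda>x. \<Sum>i\<in>{..n}. (- 1) ^ i *\<^sub>R f (omit n i x))"
  proof (rule continuous_map_signed_sum)
    fix i assume "i \<in> {..n}"
    then show "continuous_map (group_power (Suc n)) euclidean (\<lambda>x. f (omit n i x))"
      using continuous_map_compose[OF continuous_map_omit cochains_continuous[OF f], of i]
      by (simp add: o_def)
  qed
  then show "continuous_map (group_power (Suc n)) euclidean (coboundary_map n f)"
    by (rule continuous_map_eq) (simp add: coboundary_map_apply)
  show "coboundary_map n f x \<in> W" if "x \<in> topspace (group_power (Suc n))" for x
    unfolding coboundary_map_apply[OF that]
    by (rule signed_sum_closed[OF W]) (rule cochains_value[OF f omit_in_topspace])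
qed (rule coboundary_map_outside)

lemma prism_homotopy_cochain:
  assumes W: "real_vector.subspace W" and f: "f \<in> cochains (Suc n) W"
  shows "prism_homotopy n z f \<in> cochains n W"
proof (rule cochainsI)
  have "continuous_map (group_power n) euclidean (\<lambda>x. \<Sum>i\<in>{..<n}. (- 1) ^ i *\<^sub>R f (prism n z i x))"
  proof (rule continuous_map_signed_sum)
    fix i assume "i \<in> {..<n}"
    then show "continuous_map (group_power n) euclidean (\<lambda>x. f (prism n z i x))"
      using continuous_map_compose[OF continuous_map_prism cochains_continuous[OF f], of i]
      by (simp add: o_def)
  qed
  then show "continuous_map (group_power n) euclidean (prism_homotopy n z f)"
    by (rule continuous_map_eq) (simp add: prism_homotopy_def)
  show "prism_homotopy n z f x \<in> W" if "x \<in> topspace (group_power n)" for x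
    unfolding prism_homotopy_def using that
    by (simp add: signed_sum_closed[OF W] cochains_value[OF f prism_in_topspace])
qed (simp add: prism_homotopy_def)


section \<open>Reduced cohomology\<close>

context bounded_module
begin

lemma invariant_cochains_iff:
  "f \<in> invariant_cochains \<rho> n W \<longleftrightarrow> f \<in> cochains n W \<and>
     (\<forall>g. \<forall>x\<in>topspace (group_power n). f (\<lambda>j\<in>{..<n}. g + x j) = \<rho> g (f x))"
  by (simp add: invariant_cochains_def)

lemma real_subspace: "subspace W \<Longrightarrow> real_vector.subspace W"
  unfolding real_vector.subspace_def using subspace_0 subspace_add subspace_scale
  by (metis scale_of_real)

lemma translate_in_topspace: "(\<lambda>j\<in>{..<n}. g + x j) \<in> topspace (group_power n)"
  by (simp add: topspace_group_power)

lemma coboundary_map_invariant: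
  assumes W: "subspace W" and f: "f \<in> invariant_cochains \<rho> n W"
  shows "coboundary_map n f \<in> invariant_cochains \<rho> (Suc n) W"
  unfolding invariant_cochains_iff
proof (intro conjI allI ballI)
  show "coboundary_map n f \<in> cochains (Suc n) W"
    using f by (simp add: invariant_cochains_iff coboundary_map_cochain[OF real_subspace[OF W]])
  fix g and x :: "nat \<Rightarrow> 'g" assume x: "x \<in> topspace (group_power (Suc n))"
  have "omit n i (\<lambda>j\<in>{..<Suc n}. g + x j) = (\<lambda>j\<in>{..<n}. g + omit n i x j)" for i
    unfolding omit_def by (intro restrict_ext) auto
  then show "coboundary_map n f (\<lambda>j\<in>{..<Suc n}. g + x j) = \<rho> g (coboundary_map n f x)"
    using f unfolding coboundary_map_apply[OF x] coboundary_map_apply[OF translate_in_topspace]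
    by (simp add: invariant_cochains_iff omit_in_topspace linear_sum[OF linear_rho]
        linear_cmul[OF linear_rho])
qed

text \<open>The homotopy makes sense for every z; centrality enters here, since z g = g z makes the
  prism over a translate by g the translate of the prism.\<close>

lemma prism_homotopy_invariant:
  assumes W: "subspace W" and f: "f \<in> invariant_cochains \<rho> (Suc n) W" and z: "z \<in> group_center"
  shows "prism_homotopy n z f \<in> invariant_cochains \<rho> n W"
  unfolding invariant_cochains_iff
proof (intro conjI allI ballI)
  show "prism_homotopy n z f \<in> cochains n W"
    using f by (simp add: invariant_cochains_iff prism_homotopy_cochain[OF real_subspace[OF W]])
  fix g and x :: "nat \<Rightarrow> 'g" assume x: "x \<in> topspace (group_power n)"
  have "z + g = g + z" using z by (simp add: group_center_def)
  then have "z + (g + y) = g + (z + y)" for y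
    by (simp only: add.assoc[symmetric])
  then have "prism n z i (\<lambda>j\<in>{..<n}. g + x j) = (\<lambda>j\<in>{..<Suc n}. g + prism n z i x j)" if "i < n" for i
    unfolding prism_def using that by (intro restrict_ext) auto
  then show "prism_homotopy n z f (\<lambda>j\<in>{..<n}. g + x j) = \<rho> g (prism_homotopy n z f x)"
    using f x translate_in_topspace[of g x n]
    by (simp add: prism_homotopy_def invariant_cochains_iff prism_in_topspace
        linear_sum[OF linear_rho] linear_cmul[OF linear_rho])
qed

text \<open>Bounded equivariant operators act on cochains. The instances are scalar multiplication,
  the central averages, P and the complementary projection.\<close>

lemma invariant_cochains_compose:
  assumes T: "bounded_linear T" and comm: "\<And>g v. T (\<rho> g v) = \<rho> g (T v)"
    and W: "T ` W \<subseteq> W'" and f: "f \<in> invariant_cochains \<rho> n W"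
  shows "(\<lambda>x. T (f x)) \<in> invariant_cochains \<rho> n W'"
  unfolding invariant_cochains_iff
proof (intro conjI allI ballI)
  have f': "f \<in> cochains n W" using f by (simp add: invariant_cochains_iff)
  show "(\<lambda>x. T (f x)) \<in> cochains n W'"
  proof (rule cochainsI)
    have "continuous_map euclidean euclidean T"
      using bounded_linear.continuous_on[OF T continuous_on_id] by simp
    from continuous_map_compose[OF cochains_continuous[OF f'] this]
    show "continuous_map (group_power n) euclidean (\<lambda>x. T (f x))" by (simp add: o_def)
  qed (use W cochains_value[OF f'] cochains_outside[OF f'] linear_0[OF bounded_linear.linear[OF T]] in auto)
qed (use f comm in \<open>auto simp: invariant_cochains_iff\<close>)

lemma cocycles_compose:
  assumes T: "bounded_linear T" and comm: "\<And>g v. T (\<rho> g v) = \<rho> g (T v)"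
    and W: "T ` W \<subseteq> W'" and f: "f \<in> cocycles \<rho> n W"
  shows "(\<lambda>x. T (f x)) \<in> cocycles \<rho> n W'"
  using f invariant_cochains_compose[OF T comm W, of f "Suc n"]
    linear_0[OF bounded_linear.linear[OF T]]
  by (auto simp: cocycles_def coboundary_map_linear_compose[OF bounded_linear.linear[OF T]] fun_eq_iff)

lemma coboundaries_compose:
  assumes T: "bounded_linear T" and comm: "\<And>g v. T (\<rho> g v) = \<rho> g (T v)"
    and W: "T ` W \<subseteq> W'" and f: "f \<in> coboundaries \<rho> n W"
  shows "(\<lambda>x. T (f x)) \<in> coboundaries \<rho> n W'"
proof -
  obtain h where h: "h \<in> invariant_cochains \<rho> n W" "f = coboundary_map n h"
    using f by (auto simp: coboundaries_def)
  show ?thesis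
    unfolding coboundaries_def
    using invariant_cochains_compose[OF T comm W h(1)]
    by (intro image_eqI[of _ _ "\<lambda>x. T (h x)"])
      (auto simp: h(2) coboundary_map_linear_compose[OF bounded_linear.linear[OF T]])
qed

lemma smul_image: "subspace W \<Longrightarrow> smul c ` W \<subseteq> W"
  by (auto intro: subspace_scale)

lemma invariant_cochains_mono: "W \<subseteq> W' \<Longrightarrow> invariant_cochains \<rho> n W \<subseteq> invariant_cochains \<rho> n W'"
  by (auto simp: invariant_cochains_iff dest: cochains_mono[THEN subsetD])

lemma invariant_cochains_subset: "invariant_cochains \<rho> n W \<subseteq> cochains n UNIV"
  by (auto simp: invariant_cochains_iff intro: cochains_mono[THEN subsetD, OF subset_UNIV])

lemma cocycles_mono: "W \<subseteq> W' \<Longrightarrow> cocycles \<rho> n W \<subseteq> cocycles \<rho> n W'"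
  using invariant_cochains_mono[of W W' "Suc n"] by (auto simp: cocycles_def)

lemma cocycles_subset: "cocycles \<rho> n W \<subseteq> cochains (Suc n) UNIV"
  using invariant_cochains_subset[of "Suc n" W] by (auto simp: cocycles_def)

lemma coboundaries_mono: "W \<subseteq> W' \<Longrightarrow> coboundaries \<rho> n W \<subseteq> coboundaries \<rho> n W'"
  using invariant_cochains_mono[of W W' n] by (auto simp: coboundaries_def)

lemma coboundaries_subset_cocycles: "subspace W \<Longrightarrow> coboundaries \<rho> n W \<subseteq> cocycles \<rho> n W"
  using coboundary_map_invariant[of W _ n] by (auto simp: coboundaries_def cocycles_def coboundary_coboundary)

lemma invariant_cochains_add:
  assumes W: "subspace W" and f: "f \<in> invariant_cochains \<rho> n W" and g: "g \<in> invariant_cochains \<rho> n W"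
  shows "f + g \<in> invariant_cochains \<rho> n W"
  unfolding invariant_cochains_iff
proof (intro conjI allI ballI)
  have f': "f \<in> cochains n W" and g': "g \<in> cochains n W"
    using f g by (auto simp: invariant_cochains_iff)
  show "f + g \<in> cochains n W"
  proof (rule cochainsI)
    have "continuous_map (group_power n) euclidean (\<lambda>x. f x + g x)"
      by (rule continuous_map_add[OF cochains_continuous[OF f'] cochains_continuous[OF g']])
    then show "continuous_map (group_power n) euclidean (f + g)" by (simp add: plus_fun_def)
  qed (use cochains_value[OF f'] cochains_value[OF g'] cochains_outside[OF f'] cochains_outside[OF g']
      in \<open>auto intro: subspace_add[OF W]\<close>)
qed (use f g in \<open>auto simp: invariant_cochains_iff linear_add[OF linear_rho]\<close>)

lemma invariant_cochains_scale:
  assumes W: "subspace W" and f: "f \<in> invariant_cochains \<rho> n W"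
  shows "pointwise_scale smul c f \<in> invariant_cochains \<rho> n W"
  unfolding pointwise_scale_def
  by (rule invariant_cochains_compose[OF bounded_linear_smul rho_smul[symmetric] smul_image[OF W] f])

lemma zero_invariant_cochain:
  assumes W: "subspace W"
  shows "0 \<in> invariant_cochains \<rho> n W"
  unfolding invariant_cochains_iff
  by (auto intro!: cochainsI subspace_0[OF W] simp: linear_0[OF linear_rho] zero_fun_def)

lemma module_pointwise_scale: "Modules.module (pointwise_scale smul)"
  by unfold_locales
    (auto simp: pointwise_scale_def fun_eq_iff scale_right_distrib scale_left_distrib)

lemma subspace_cocycles:
  assumes W: "subspace W"
  shows "module.subspace (pointwise_scale smul) (cocycles \<rho> n W)"
  unfolding module.subspace_def[OF module_pointwise_scale]
proof (intro conjI ballI allI)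
  show "0 \<in> cocycles \<rho> n W"
    by (simp add: cocycles_def zero_invariant_cochain[OF W] coboundary_map_zero)
  show "f + g \<in> cocycles \<rho> n W" if "f \<in> cocycles \<rho> n W" "g \<in> cocycles \<rho> n W" for f g
    using that by (simp add: cocycles_def invariant_cochains_add[OF W] coboundary_map_add)
  show "pointwise_scale smul c f \<in> cocycles \<rho> n W" if "f \<in> cocycles \<rho> n W" for c f
    unfolding pointwise_scale_def
    by (rule cocycles_compose[OF bounded_linear_smul rho_smul[symmetric] smul_image[OF W] that])
qed

lemma subspace_coboundaries:
  assumes W: "subspace W"
  shows "module.subspace (pointwise_scale smul) (coboundaries \<rho> n W)"
  unfolding module.subspace_def[OF module_pointwise_scale]
proof (intro conjI ballI allI)
  show "0 \<in> coboundaries \<rho> n W"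
    unfolding coboundaries_def
    by (rule image_eqI[OF _ zero_invariant_cochain[OF W]]) (simp add: coboundary_map_zero)
  show "f + g \<in> coboundaries \<rho> n W" if "f \<in> coboundaries \<rho> n W" "g \<in> coboundaries \<rho> n W" for f g
    using that invariant_cochains_add[OF W]
    by (auto simp: coboundaries_def simp flip: coboundary_map_add)
  show "pointwise_scale smul c f \<in> coboundaries \<rho> n W" if "f \<in> coboundaries \<rho> n W" for c f
    unfolding pointwise_scale_def
    by (rule coboundaries_compose[OF bounded_linear_smul rho_smul[symmetric] smul_image[OF W] that])
qed

lemma invariant_cochain_topology_eq:
  "invariant_cochain_topology \<rho> n W = uniform_topology n (invariant_cochains \<rho> n W)"
  unfolding invariant_cochain_topology_def
  by (rule subtopology_compact_open) (auto simp: invariant_cochains_iff)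

lemma cocycle_topology_eq:
  "cocycle_topology \<rho> n W = uniform_topology (Suc n) (cocycles \<rho> n W)"
  unfolding cocycle_topology_def invariant_cochain_topology_eq
  by (rule subtopology_uniform_topology) (auto simp: cocycles_def)

lemma topspace_cocycle_topology: "topspace (cocycle_topology \<rho> n W) = cocycles \<rho> n W"
  unfolding cocycle_topology_eq by (rule topspace_uniform_topology[OF cocycles_subset])

lemma in_closed_coboundaries:
  assumes W: "subspace W"
  shows "f \<in> closed_coboundaries \<rho> n W \<longleftrightarrow> f \<in> invariant_cochains \<rho> (Suc n) W \<and>
    (\<forall>K e. compactin (group_power (Suc n)) K \<and> 0 < e \<longrightarrow> (\<exists>g\<in>coboundaries \<rho> n W. uniform_close f K e g))"
  unfolding closed_coboundaries_def invariant_cochain_topology_eq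
  using coboundaries_subset_cocycles[OF W, of n]
  by (intro in_closure_uniform_topology invariant_cochains_subset) (auto simp: cocycles_def)

lemma subspace_closed_coboundaries:
  assumes W: "subspace W"
  shows "module.subspace (pointwise_scale smul) (closed_coboundaries \<rho> n W)"
  unfolding module.subspace_def[OF module_pointwise_scale]
proof (intro conjI ballI allI)
  note B = subspace_coboundaries[OF W]
  show "0 \<in> closed_coboundaries \<rho> n W"
    unfolding in_closed_coboundaries[OF W]
    by (auto simp: zero_invariant_cochain[OF W] uniform_close_def
        intro!: bexI[OF _ module.subspace_0[OF module_pointwise_scale B]])
  show "f + g \<in> closed_coboundaries \<rho> n W"
    if f: "f \<in> closed_coboundaries \<rho> n W" and g: "g \<in> closed_coboundaries \<rho> n W" for f g
    unfolding in_closed_coboundaries[OF W]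
  proof (intro conjI allI impI)
    show "f + g \<in> invariant_cochains \<rho> (Suc n) W"
      using f g by (auto simp: in_closed_coboundaries[OF W] intro: invariant_cochains_add[OF W])
    fix K :: "(nat \<Rightarrow> 'g) set" and e :: real assume "compactin (group_power (Suc n)) K \<and> 0 < e"
    then have K: "compactin (group_power (Suc n)) K \<and> 0 < e / 2" by simp
    obtain a b where a: "a \<in> coboundaries \<rho> n W" "uniform_close f K (e / 2) a"
      and b: "b \<in> coboundaries \<rho> n W" "uniform_close g K (e / 2) b"
      using f g K unfolding in_closed_coboundaries[OF W] by blast
    have "uniform_close (f + g) K e (a + b)"
      unfolding uniform_close_def
    proof
      fix x assume "x \<in> K"
      then have "norm (a x - f x) < e / 2" "norm (b x - g x) < e / 2"
        using a(2) b(2) by (auto simp: uniform_close_def)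
      then show "norm ((a + b) x - (f + g) x) < e"
        unfolding plus_fun_apply by norm
    qed
    then show "\<exists>h\<in>coboundaries \<rho> n W. uniform_close (f + g) K e h"
      using module.subspace_add[OF module_pointwise_scale B a(1) b(1)] by blast
  qed
  show "pointwise_scale smul c f \<in> closed_coboundaries \<rho> n W"
    if f: "f \<in> closed_coboundaries \<rho> n W" for c f
    unfolding in_closed_coboundaries[OF W]
  proof (intro conjI allI impI)
    show "pointwise_scale smul c f \<in> invariant_cochains \<rho> (Suc n) W"
      using f by (auto simp: in_closed_coboundaries[OF W] intro: invariant_cochains_scale[OF W])
    fix K :: "(nat \<Rightarrow> 'g) set" and e :: real assume K: "compactin (group_power (Suc n)) K \<and> 0 < e"
    \<comment> \<open>A positive constant, so that e / C is a valid tolerance also for c =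
      0.\<close>
    define C where "C = norm c + 1"
    have C: "0 < C" "norm c \<le> C" by (auto simp: C_def add_nonneg_pos)
    with K have "compactin (group_power (Suc n)) K \<and> 0 < e / C" by simp
    then obtain a where a: "a \<in> coboundaries \<rho> n W" "uniform_close f K (e / C) a"
      using f unfolding in_closed_coboundaries[OF W] by blast
    have "uniform_close (pointwise_scale smul c f) K e (pointwise_scale smul c a)"
      unfolding uniform_close_def
    proof
      fix x assume "x \<in> K"
      have "norm (pointwise_scale smul c a x - pointwise_scale smul c f x) = norm c * norm (a x - f x)"
        by (simp add: pointwise_scale_def norm_scale flip: scale_right_diff_distrib)
      also have "\<dots> \<le> C * norm (a x - f x)" using C by (intro mult_right_mono) auto
      also have "\<dots> < e" using a(2) \<open>x \<in> K\<close> C by (auto simp: uniform_close_def field_simps)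
      finally show "norm (pointwise_scale smul c a x - pointwise_scale smul c f x) < e" .
    qed
    then show "\<exists>h\<in>coboundaries \<rho> n W. uniform_close (pointwise_scale smul c f) K e h"
      using module.subspace_scale[OF module_pointwise_scale B a(1)] by blast
  qed
qed

lemma closed_coboundaries_mono:
  assumes W: "subspace W" "subspace W'" "W \<subseteq> W'"
  shows "closed_coboundaries \<rho> n W \<subseteq> closed_coboundaries \<rho> n W'"
proof
  fix f assume "f \<in> closed_coboundaries \<rho> n W"
  then show "f \<in> closed_coboundaries \<rho> n W'"
    using invariant_cochains_mono[OF W(3)] coboundaries_mono[OF W(3)]
    unfolding in_closed_coboundaries[OF W(1)] in_closed_coboundaries[OF W(2)] by blast
qed

text \<open>The cocycle identity at a point x involves only the n + 2 values of f at the faces of x.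
  These faces form a finite, hence compact, set, on which f is approximated by coboundaries.\<close>

lemma closed_coboundaries_subset_cocycles:
  assumes W: "subspace W"
  shows "closed_coboundaries \<rho> n W \<subseteq> cocycles \<rho> n W"
proof
  fix f assume f: "f \<in> closed_coboundaries \<rho> n W"
  have "coboundary_map (Suc n) f x = 0" for x
  proof (cases "x \<in> topspace (group_power (Suc (Suc n)))")
    case x: True
    show ?thesis
    proof (rule ccontr)
      let ?d = "coboundary_map (Suc n) f x"
      assume "?d \<noteq> 0"
      \<comment> \<open>Each of the n + 2 terms contributes less than e, so the total stays strictly
        below the norm of \<open>?d\<close>.\<close>
      define e where "e = norm ?d / real (Suc (Suc n))"
      have e: "0 < e" using \<open>?d \<noteq> 0\<close> by (simp add: e_def)
      let ?K = "(\<lambda>i. omit (Suc n) i x) ` {..Suc n}"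
      have "compactin (group_power (Suc n)) ?K"
        by (rule finite_imp_compactin) (auto simp: omit_in_topspace)
      then obtain g where g: "g \<in> coboundaries \<rho> n W" "uniform_close f ?K e g"
        using f e unfolding in_closed_coboundaries[OF W] by blast
      have "coboundary_map (Suc n) g x = 0"
        using coboundaries_subset_cocycles[OF W, of n] g(1) by (auto simp: cocycles_def)
      then have "norm ?d = norm (coboundary_map (Suc n) g x - ?d)" by simp
      also have "\<dots> = norm (\<Sum>i\<le>Suc n. (- 1) ^ i *\<^sub>R (g (omit (Suc n) i x) - f (omit (Suc n) i x)))"
        by (simp only: coboundary_map_apply[OF x] sum_subtractf scaleR_diff_right)
      also have "\<dots> \<le> (\<Sum>i\<le>Suc n. norm (g (omit (Suc n) i x) - f (omit (Suc n) i x)))"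
        by (rule order_trans[OF norm_sum]) (simp add: power_abs)
      also have "\<dots> < (\<Sum>i\<le>Suc n. e)"
        using g(2) by (intro sum_strict_mono) (auto simp: uniform_close_def)
      also have "\<dots> = norm ?d" by (simp add: e_def)
      finally show False by simp
    qed
  qed (rule coboundary_map_outside)
  then show "f \<in> cocycles \<rho> n W"
    using f by (auto simp: cocycles_def in_closed_coboundaries[OF W])
qed

end

section \<open>Splitting the cocycles along the ergodic decomposition\<close>

context stationary_module
begin

text \<open>For one central z this is the prism homotopy combined with invariance, f (z x) =
  \<open>\<rho> z\<close> (f x). For a composition, f - S T f = (f - T f) + (T f - S (T f)), where
  the hypothesis for S is applied to the cocycle T f; hence the induction is over all f.\<close>

lemma cocycle_diff_central_mean:
  assumes "T \<in> central_means" "f \<in> cocycles \<rho> n V0"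
  shows "(\<lambda>x. f x - T (f x)) \<in> coboundaries \<rho> n V0"
  using assms
proof (induction arbitrary: f rule: central_means.induct)
  note B_add = module.subspace_add[OF module_pointwise_scale subspace_coboundaries[OF subspace_V0]]
    and B_scale = module.subspace_scale[OF module_pointwise_scale subspace_coboundaries[OF subspace_V0]]
  {
    case (central_means_rho z)
    have f: "f \<in> invariant_cochains \<rho> (Suc n) V0" "coboundary_map (Suc n) f = 0"
      using central_means_rho by (auto simp: cocycles_def)
    have "coboundary_map n (prism_homotopy n z f) = (\<lambda>x. \<rho> z (f x) - f x)"
    proof
      fix x
      show "coboundary_map n (prism_homotopy n z f) x = \<rho> z (f x) - f x"
      proof (cases "x \<in> topspace (group_power (Suc n))")
        case True
        then show ?thesis
          using coboundary_prism_homotopy[OF f(2) True, of z] f(1) by (simp add: invariant_cochains_iff)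
      next
        case False
        then show ?thesis
          using f(1) cochains_outside[of f "Suc n" V0 x]
          by (simp add: coboundary_map_outside invariant_cochains_iff linear_0[OF linear_rho])
      qed
    qed
    moreover have "coboundary_map n (prism_homotopy n z f) \<in> coboundaries \<rho> n V0"
      unfolding coboundaries_def
      by (intro imageI prism_homotopy_invariant[OF subspace_V0 f(1)] central_means_rho.hyps)
    ultimately have "(\<lambda>x. \<rho> z (f x) - f x) \<in> coboundaries \<rho> n V0" by simp
    then have "pointwise_scale smul (- 1) (\<lambda>x. \<rho> z (f x) - f x) \<in> coboundaries \<rho> n V0"
      by (rule B_scale)
    then show ?case by (simp add: pointwise_scale_def)
  next
    case (central_means_convex S T t)
    have "pointwise_scale smul (of_real t) (\<lambda>x. f x - S (f x)) +
        pointwise_scale smul (of_real (1 - t)) (\<lambda>x. f x - T (f x)) \<in> coboundaries \<rho> n V0"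
      by (intro B_add B_scale central_means_convex.IH central_means_convex.prems)
    also have "pointwise_scale smul (of_real t) (\<lambda>x. f x - S (f x)) +
        pointwise_scale smul (of_real (1 - t)) (\<lambda>x. f x - T (f x)) =
        (\<lambda>x. f x - (t *\<^sub>R S (f x) + (1 - t) *\<^sub>R T (f x)))"
      by (rule ext) (simp only: pointwise_scale_def scale_of_real plus_fun_apply, simp add: algebra_simps)
    finally show ?case .
  next
    case (central_means_compose S T)
    have "(\<lambda>x. T (f x)) \<in> cocycles \<rho> n V0"
      using central_means_compose.hyps(2) central_means_compose.prems
      by (intro cocycles_compose[OF central_means_bounded_linear _ _ central_means_compose.prems])
        (auto intro: central_means_V0 simp: central_means_rho_commute)
    then have "(\<lambda>x. f x - T (f x)) + (\<lambda>x. T (f x) - S (T (f x))) \<in> coboundaries \<rho> n V0"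
      by (intro B_add central_means_compose.IH central_means_compose.prems)
    then show ?case by (simp add: plus_fun_def)
  }
qed

text \<open>The coboundary approximating f on K is f - T f. Its error is T f, which is small on K as
  soon as T is small on the compact set of values of f there.\<close>

lemma closed_coboundaries_V0: "closed_coboundaries \<rho> n V0 = cocycles \<rho> n V0"
proof
  show "closed_coboundaries \<rho> n V0 \<subseteq> cocycles \<rho> n V0"
    by (rule closed_coboundaries_subset_cocycles[OF subspace_V0])
  show "cocycles \<rho> n V0 \<subseteq> closed_coboundaries \<rho> n V0"
  proof
    fix f assume f: "f \<in> cocycles \<rho> n V0"
    then have inv: "f \<in> invariant_cochains \<rho> (Suc n) V0" by (simp add: cocycles_def)
    then have coch: "f \<in> cochains (Suc n) V0" by (simp add: invariant_cochains_iff)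
    show "f \<in> closed_coboundaries \<rho> n V0"
      unfolding in_closed_coboundaries[OF subspace_V0]
    proof (intro conjI allI impI inv)
      fix K :: "(nat \<Rightarrow> 'g) set" and e :: real assume K: "compactin (group_power (Suc n)) K \<and> 0 < e"
      obtain T where T: "T \<in> central_means" "\<And>v. v \<in> f ` K \<Longrightarrow> norm (T v) < e"
        using central_means_small_on_compact[of "f ` K" e] cochains_image_compact[OF coch, of K] K
        by blast
      show "\<exists>g\<in>coboundaries \<rho> n V0. uniform_close f K e g"
        by (rule bexI[OF _ cocycle_diff_central_mean[OF T(1) f]])
          (use T(2) in \<open>auto simp: uniform_close_def\<close>)
    qed
  qed
qed

lemma P_image: "P ` UNIV \<subseteq> Vmu"
  using P_in_Vmu by blast

lemma cocycles_P: "f \<in> cocycles \<rho> n UNIV \<Longrightarrow> (\<lambda>x. P (f x)) \<in> cocycles \<rho> n Vmu"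
  by (rule cocycles_compose[OF bounded_linear_P P_rho P_image])

lemma cocycles_diff_P: "f \<in> cocycles \<rho> n UNIV \<Longrightarrow> (\<lambda>x. f x - P (f x)) \<in> cocycles \<rho> n V0"
  by (rule cocycles_compose[where T = "\<lambda>v. v - P v"])
    (auto intro: bounded_linear_sub bounded_linear_P bounded_linear_ident diff_P_V0
      simp: P_rho linear_diff[OF linear_rho])

lemma cocycles_value: "f \<in> cocycles \<rho> n W \<Longrightarrow> subspace W \<Longrightarrow> f x \<in> W"
  using cochains_value[of f "Suc n" W x] cochains_outside[of f "Suc n" W x] subspace_0[of W]
  by (cases "x \<in> topspace (group_power (Suc n))") (auto simp: cocycles_def invariant_cochains_iff)

lemma norm_P_le_pos:
  obtains C where "0 < C" "\<And>v. norm (P v) \<le> C * norm v"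
proof (rule that[of "rho_bound + 1"])
  show "0 < rho_bound + 1" using rho_bound_nonneg by simp
  show "norm (P v) \<le> (rho_bound + 1) * norm v" for v
    using norm_P_le[of v] norm_ge_zero[of v] unfolding distrib_right by linarith
qed

lemma continuous_map_P:
  "continuous_map (cocycle_topology \<rho> n UNIV) (cocycle_topology \<rho> n Vmu) (\<lambda>f x. P (f x))"
  unfolding cocycle_topology_eq
proof -
  obtain C where C: "0 < C" "\<And>v. norm (P v) \<le> C * norm v" by (rule norm_P_le_pos) blast
  have "norm (P (g x) - P (f x)) \<le> C * norm (g x - f x)" for f g :: "(nat \<Rightarrow> 'g) \<Rightarrow> 'v" and x
    using C(2)[of "g x - f x"] by (simp add: linear_diff[OF bounded_linear.linear[OF bounded_linear_P]])
  then show "continuous_map (uniform_topology (Suc n) (cocycles \<rho> n UNIV))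
      (uniform_topology (Suc n) (cocycles \<rho> n Vmu)) (\<lambda>f x. P (f x))"
    by (intro continuous_map_uniform_topology[OF cocycles_subset cocycles_subset cocycles_P C(1)])
qed

lemma continuous_map_diff_P:
  "continuous_map (cocycle_topology \<rho> n UNIV) (cocycle_topology \<rho> n V0) (\<lambda>f x. f x - P (f x))"
  unfolding cocycle_topology_eq
proof -
  obtain C where C: "0 < C" "\<And>v. norm (P v) \<le> C * norm v" by (rule norm_P_le_pos) blast
  have bound: "norm (g x - P (g x) - (f x - P (f x))) \<le> (1 + C) * norm (g x - f x)"
    for f g :: "(nat \<Rightarrow> 'g) \<Rightarrow> 'v" and x
  proof -
    have "norm (g x - P (g x) - (f x - P (f x))) = norm ((g x - f x) - P (g x - f x))"
      by (simp add: linear_diff[OF bounded_linear.linear[OF bounded_linear_P]] algebra_simps)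
    also have "\<dots> \<le> norm (g x - f x) + norm (P (g x - f x))"
      by (rule norm_triangle_ineq4)
    also have "\<dots> \<le> (1 + C) * norm (g x - f x)"
      using C(2)[of "g x - f x"] unfolding distrib_right by linarith
    finally show ?thesis .
  qed
  have "0 < 1 + C" using C(1) by simp
  with bound show "continuous_map (uniform_topology (Suc n) (cocycles \<rho> n UNIV))
      (uniform_topology (Suc n) (cocycles \<rho> n V0)) (\<lambda>f x. f x - P (f x))"
    by (intro continuous_map_uniform_topology[OF cocycles_subset cocycles_subset cocycles_diff_P])
qed

lemma cocycles_add:
  "subspace W \<Longrightarrow> f \<in> cocycles \<rho> n W \<Longrightarrow> g \<in> cocycles \<rho> n W \<Longrightarrow> f + g \<in> cocycles \<rho> n W"
  by (rule module.subspace_add[OF module_pointwise_scale subspace_cocycles])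

text \<open>The inverse of addition sends f to the pair of f - P f and P f; it is continuous because
  P is bounded, and it is an inverse because P vanishes on V0 and fixes \<open>Vmu\<close>.\<close>

lemma direct_sum_cocycles:
  "topological_direct_sum (pointwise_scale smul) (cocycle_topology \<rho> n UNIV)
     (cocycles \<rho> n V0) (cocycles \<rho> n Vmu)"
proof -
  let ?Z = "cocycles \<rho> n UNIV" and ?Zo = "cocycles \<rho> n V0" and ?Zmu = "cocycles \<rho> n Vmu"
  have sub: "?Zo \<subseteq> ?Z" "?Zmu \<subseteq> ?Z" by (rule cocycles_mono[OF subset_UNIV])+
  have top: "subtopology (cocycle_topology \<rho> n UNIV) ?Zo = cocycle_topology \<rho> n V0"
    "subtopology (cocycle_topology \<rho> n UNIV) ?Zmu = cocycle_topology \<rho> n Vmu"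
    unfolding cocycle_topology_eq using sub by (simp_all add: subtopology_uniform_topology)
  have "homeomorphic_maps (prod_topology (cocycle_topology \<rho> n V0) (cocycle_topology \<rho> n Vmu))
      (cocycle_topology \<rho> n UNIV) (\<lambda>(a, b). a + b) (\<lambda>f. (\<lambda>x. f x - P (f x), \<lambda>x. P (f x)))"
    unfolding homeomorphic_maps_def
  proof (intro conjI ballI)
    show "continuous_map (prod_topology (cocycle_topology \<rho> n V0) (cocycle_topology \<rho> n Vmu))
        (cocycle_topology \<rho> n UNIV) (\<lambda>(a, b). a + b)"
      unfolding cocycle_topology_eq
      by (rule continuous_map_uniform_add[OF cocycles_subset sub])
        (use sub in \<open>auto intro: cocycles_add[OF subspace_UNIV]\<close>)
    show "continuous_map (cocycle_topology \<rho> n UNIV)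
        (prod_topology (cocycle_topology \<rho> n V0) (cocycle_topology \<rho> n Vmu))
        (\<lambda>f. (\<lambda>x. f x - P (f x), \<lambda>x. P (f x)))"
      by (rule continuous_map_pairedI[OF continuous_map_diff_P continuous_map_P])
  next
    fix p assume "p \<in> topspace (prod_topology (cocycle_topology \<rho> n V0) (cocycle_topology \<rho> n Vmu))"
    then obtain a b where p: "p = (a, b)" "a \<in> ?Zo" "b \<in> ?Zmu"
      by (auto simp: topspace_cocycle_topology)
    have "P (a x + b x) = b x" for x
      using P_V0[OF cocycles_value[OF p(2) subspace_V0, of x]]
        P_Vmu[OF cocycles_value[OF p(3) subspace_Vmu, of x]]
      by (simp add: linear_add[OF bounded_linear.linear[OF bounded_linear_P]])
    then show "(\<lambda>f. (\<lambda>x. f x - P (f x), \<lambda>x. P (f x))) (case p of (a, b) \<Rightarrow> a + b) = p"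
      by (simp add: p(1) fun_eq_iff)
  next
    fix f assume "f \<in> topspace (cocycle_topology \<rho> n UNIV)"
    show "(case (\<lambda>x. f x - P (f x), \<lambda>x. P (f x)) of (a, b) \<Rightarrow> a + b) = f"
      by (simp add: fun_eq_iff)
  qed
  then have "homeomorphic_map (prod_topology (cocycle_topology \<rho> n V0) (cocycle_topology \<rho> n Vmu))
      (cocycle_topology \<rho> n UNIV) (\<lambda>(a, b). a + b)"
    by (rule homeomorphic_maps_imp_map)
  then show ?thesis
    unfolding topological_direct_sum_def top topspace_cocycle_topology
    using sub by (simp add: subspace_cocycles subspace_V0 subspace_Vmu)
qed

text \<open>P maps coboundaries to coboundaries and is Lipschitz, so approximations survive it. This
  makes P well defined on reduced cohomology.\<close>

lemma closed_coboundaries_P: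
  assumes f: "f \<in> closed_coboundaries \<rho> n UNIV"
  shows "(\<lambda>x. P (f x)) \<in> closed_coboundaries \<rho> n Vmu"
  unfolding in_closed_coboundaries[OF subspace_Vmu]
proof (intro conjI allI impI)
  show "(\<lambda>x. P (f x)) \<in> invariant_cochains \<rho> (Suc n) Vmu"
    using f by (intro invariant_cochains_compose[OF bounded_linear_P P_rho P_image])
      (simp add: in_closed_coboundaries[OF subspace_UNIV])
  fix K :: "(nat \<Rightarrow> 'g) set" and e :: real assume K: "compactin (group_power (Suc n)) K \<and> 0 < e"
  obtain C where C: "0 < C" "\<And>v. norm (P v) \<le> C * norm v"
    by (rule norm_P_le_pos) blast
  have "compactin (group_power (Suc n)) K \<and> 0 < e / C" using K C(1) by simp
  then obtain g where g: "g \<in> coboundaries \<rho> n UNIV" "uniform_close f K (e / C) g"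
    using f unfolding in_closed_coboundaries[OF subspace_UNIV] by blast
  show "\<exists>h\<in>coboundaries \<rho> n Vmu. uniform_close (\<lambda>x. P (f x)) K e h"
  proof (rule bexI)
    show "(\<lambda>x. P (g x)) \<in> coboundaries \<rho> n Vmu"
      by (rule coboundaries_compose[OF bounded_linear_P P_rho P_image g(1)])
    show "uniform_close (\<lambda>x. P (f x)) K e (\<lambda>x. P (g x))"
      unfolding uniform_close_def
    proof
      fix x assume "x \<in> K"
      have "norm (P (g x) - P (f x)) \<le> C * norm (g x - f x)"
        using C(2)[of "g x - f x"] by (simp add: linear_diff[OF bounded_linear.linear[OF bounded_linear_P]])
      also have "\<dots> < e" using g(2) \<open>x \<in> K\<close> C(1) by (auto simp: uniform_close_def field_simps)
      finally show "norm (P (g x) - P (f x)) < e" .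
    qed
  qed
qed

text \<open>The retraction is composition with P, which is the identity on \<open>Vmu\<close>-valued
  cocycles and respects closed coboundaries.\<close>

lemma reduced_cohomology_isomorphic:
  "tvs_isomorphic (reduced_cohomology smul \<rho> n UNIV) (reduced_cohomology smul \<rho> n Vmu)"
  unfolding reduced_cohomology_def
proof (rule tvs_quotient_isomorphic[where F = "\<lambda>f x. P (f x)"])
  let ?N = "closed_coboundaries \<rho> n UNIV"
  note N = subspace_closed_coboundaries[OF subspace_UNIV, of n]
  show "continuous_map (cocycle_topology \<rho> n UNIV) (cocycle_topology \<rho> n Vmu) (\<lambda>f x. P (f x))"
    by (rule continuous_map_P)
  show "continuous_map (cocycle_topology \<rho> n Vmu) (cocycle_topology \<rho> n UNIV) (\<lambda>f. f)"
    unfolding cocycle_topology_eq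
    by (rule continuous_map_uniform_topology[where C = 1])
      (auto simp: cocycles_subset intro: cocycles_mono[THEN subsetD, OF subset_UNIV])
  show "(\<lambda>x. P ((f + g) x)) = (\<lambda>x. P (f x)) + (\<lambda>x. P (g x))" for f g :: "(nat \<Rightarrow> 'g) \<Rightarrow> 'v"
    by (simp add: fun_eq_iff linear_add[OF bounded_linear.linear[OF bounded_linear_P]])
  show "(\<lambda>x. P (pointwise_scale smul c f x)) = pointwise_scale smul c (\<lambda>x. P (f x))"
    for c and f :: "(nat \<Rightarrow> 'g) \<Rightarrow> 'v"
    by (simp add: pointwise_scale_def P_smul)
  show "0 \<in> ?N" by (rule module.subspace_0[OF module_pointwise_scale N])
  show "f + g \<in> ?N" if "f \<in> ?N" "g \<in> ?N" for f g
    using that by (rule module.subspace_add[OF module_pointwise_scale N])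
  show "- f \<in> ?N" if "f \<in> ?N" for f
  proof -
    have "pointwise_scale smul (- 1) f \<in> ?N"
      using that by (rule module.subspace_scale[OF module_pointwise_scale N])
    then show ?thesis by (simp add: pointwise_scale_def fun_Compl_def)
  qed
  show "0 \<in> closed_coboundaries \<rho> n Vmu"
    by (rule module.subspace_0[OF module_pointwise_scale subspace_closed_coboundaries[OF subspace_Vmu]])
  show "closed_coboundaries \<rho> n Vmu \<subseteq> ?N"
    by (rule closed_coboundaries_mono[OF subspace_Vmu subspace_UNIV]) simp
  show "closed_coboundaries \<rho> n Vmu \<subseteq> topspace (cocycle_topology \<rho> n Vmu)"
    unfolding topspace_cocycle_topology by (rule closed_coboundaries_subset_cocycles[OF subspace_Vmu])
  show "(\<lambda>f x. P (f x)) ` ?N \<subseteq> closed_coboundaries \<rho> n Vmu"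
    by (auto intro: closed_coboundaries_P)
  show "(\<lambda>x. P (f x)) = f" if "f \<in> topspace (cocycle_topology \<rho> n Vmu)" for f
    using that cocycles_value[OF _ subspace_Vmu] by (auto simp: topspace_cocycle_topology P_Vmu)
  \<comment> \<open>Here the density of coboundaries among V0-valued cocycles enters: the component
    removed by P represents the zero class.\<close>
  show "f - (\<lambda>x. P (f x)) \<in> ?N" if "f \<in> topspace (cocycle_topology \<rho> n UNIV)" for f
  proof -
    have "f - (\<lambda>x. P (f x)) \<in> closed_coboundaries \<rho> n V0"
      using cocycles_diff_P[of f n] that
      by (simp add: closed_coboundaries_V0 topspace_cocycle_topology fun_diff_def)
    then show ?thesis
      using closed_coboundaries_mono[OF subspace_V0 subspace_UNIV] by blast
  qed
qed

end

theorem corollary4p7: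
  fixes smul :: "'k::real_or_complex \<Rightarrow> 'v::banach \<Rightarrow> 'v"
    and \<rho> :: "'g::topological_group_add \<Rightarrow> 'v \<Rightarrow> 'v"
    and \<mu> :: "'g measure"
    and n :: nat
  assumes "banach_space_over smul"
    and "\<mu> \<in> baire_prob_measures (top_of_set group_center)"
    and "uniformly_bounded_module smul UNIV \<rho>"
    and "strongly_operator_continuous UNIV \<rho>"
    and "weakly_uniquely_stationary smul group_center \<mu> \<rho>"
  shows "topological_direct_sum (pointwise_scale smul) (cocycle_topology \<rho> n UNIV)
           (closed_coboundaries \<rho> n (closure (range (Delta_mu smul \<mu> \<rho>))))
           (cocycles \<rho> n (mu_fixed smul \<mu> \<rho>)) \<and>
         tvs_isomorphic (reduced_cohomology smul \<rho> n UNIV)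
           (reduced_cohomology smul \<rho> n (mu_fixed smul \<mu> \<rho>))"
proof -
  interpret banach_space_over smul by fact
  interpret stationary_module smul \<rho> \<mu>
    by unfold_locales fact+
  show ?thesis
    unfolding closed_coboundaries_V0 using direct_sum_cocycles reduced_cohomology_isomorphic by blast
qed

end
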